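(* Let $\gamma\in\mathbb{R}$ and $-1<m\leq-\frac12$. The boundary value problem $$f'''+(m+2)ff''-(2m+1)f'^2=0 \text{ on } [0,\infty),\qquad f(0)=-\gamma,\quad f''(0)=-1,\quad f'(\infty)=0$$ admits a bounded solution $f$. This solution is positive at infinity, increasing, strictly concave, and satisfies $$\forall t\geq 0,\quad -\gamma\leq f(t)\leq\sqrt{\gamma^2+2\frac{f'(0)}{m+2}}.$$ Moreover, if $\gamma\leq 0$, such a (bounded) solution is unique.
   Context: Here $f'(\infty):=\lim_{t\to\infty}f'(t)$. A solution is a three times differentiable function $f:[0,\infty)\to\mathbb{R}$ satisfying the differential equation on $[0,\infty)$ together with all three boundary conditions; $f'(0)$ is not prescribed. "Positive at infinity" means $f(t)>0$ for all sufficiently large $t$. *)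

theory Defs
  imports "HOL-Analysis.Analysis"
begin

(* Functions on [0,\<infinity>) are represented by total functions on the reals; the derivative below
   only looks at values on [0,\<infinity>), so at 0 it is the right-sided derivative.
   Values at negative arguments carry no meaning. *)
definition hderiv :: "(real \<Rightarrow> real) \<Rightarrow> real \<Rightarrow> real" where
  "hderiv f t = vector_derivative f (at t within {0..})"

definition three_times_differentiable :: "(real \<Rightarrow> real) \<Rightarrow> bool" where
  "three_times_differentiable f \<longleftrightarrow>
     f differentiable_on {0..} \<and>
     hderiv f differentiable_on {0..} \<and>
     hderiv (hderiv f) differentiable_on {0..}"

definition bvp_solution :: "real \<Rightarrow> real \<Rightarrow> (real \<Rightarrow> real) \<Rightarrow> bool" where
  "bvp_solution m \<gamma> f \<longleftrightarrow>
     three_times_differentiable f \<and>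
     (\<forall>t\<ge>0. hderiv (hderiv (hderiv f)) t + (m + 2) * f t * hderiv (hderiv f) t
              - (2 * m + 1) * (hderiv f t)\<^sup>2 = 0) \<and>
     f 0 = - \<gamma> \<and>
     hderiv (hderiv f) 0 = - 1 \<and>
     (hderiv f \<longlongrightarrow> 0) at_top"

definition strictly_concave_on :: "real set \<Rightarrow> (real \<Rightarrow> real) \<Rightarrow> bool" where
  "strictly_concave_on S f \<longleftrightarrow>
     convex S \<and>
     (\<forall>x\<in>S. \<forall>y\<in>S. \<forall>u. x \<noteq> y \<longrightarrow> 0 < u \<longrightarrow> u < 1 \<longrightarrow>
        (1 - u) * f x + u * f y < f ((1 - u) * x + u * y))"

end

(*
  Put a = m + 2, b = 3 (m + 1), w = f' + a/2 f^2 and E = f'' + a f f'. The equation becomes the first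
  order system f' = w - a/2 f^2, w' = E, E' = b f'^2, so E is nondecreasing.

  Existence is by shooting in alpha = f'(0). As long as f' >= 0 and E <= 0, the quantity w
  decreases, hence a/2 f^2 <= w <= alpha + a/2 gamma^2, and f'' < 0. If f' vanishes first, then
  E = f'' < 0; if E vanishes first, then f' > 0. Both events are stable under perturbation of alpha;
  the first one occurs for small negative alpha, the second one for large alpha (on the time scale
  alpha^(-1/2) the slope stays above alpha/2, and the growth alpha^(3/2) of E beats E(0) = O(alpha)).
  By connectedness some alpha in between has neither, and its solution stays in the region forever.

  For uniqueness, write f' = V(s) and E = G(s) as functions of s = f on [-gamma, L), L = f(infinity):
  V' = G/V - a s, G' = b V, G <= 0, and V, G tend to 0 at L. If two solutions start with V1 < V2, then
  G1 <= G2 because -gamma >= 0, and V2 - V1 and G2 - G1 are nondecreasing, so V and G cannot both vanish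
  at their respective right ends. Hence f'(0) is determined.
*)
theory Submission
  imports Defs "HOL-Real_Asymp.Real_Asymp"
begin

section \<open>Functions on the half-line\<close>

text \<open>The two bounds on m are two signs. -1 < m is b > 0, which makes E monotone; m <= -1/2 is
  a - b = -(2 m + 1) >= 0, which turns f''' = - a f f'' - (a - b) f'^2 into a linear differential
  inequality preserving f'' < 0. The obstacle to shooting is the quadratic nonlinearity: a solution
  might cease to exist before either event occurs, so that neither the events nor their stability
  could be stated for all alpha at once. Inside the region f' >= 0, E <= 0, however, f and f' obey
  explicit bounds, and both are cut off beyond these. The truncated system is globally Lipschitz;
  its solutions are global, depend Lipschitz continuously on alpha on bounded time intervals, and
  solve the original equation as long as they stay in the region. The condition at infinity is not
  part of the shooting: in the region f is bounded while f' is positive and decreasing, so f' tends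
  to 0. The Lipschitz estimate is used once more at the end of the uniqueness proof, where equal
  values of f'(0) have to give equal solutions.\<close>

lemma halfline_MVT:
  fixes f f' :: "real \<Rightarrow> real"
  assumes ab: "0 \<le> a" "a < b"
    and f: "\<And>t. a \<le> t \<Longrightarrow> t \<le> b \<Longrightarrow> (f has_real_derivative f' t) (at t within {0..})"
  obtains \<xi> where "a < \<xi>" "\<xi> < b" "f b - f a = (b - a) * f' \<xi>"
proof -
  have "continuous_on {a..b} f"
    using f ab unfolding continuous_on_eq_continuous_within
    by (meson DERIV_continuous atLeastAtMost_iff atLeast_iff continuous_within_subset
        order_trans subsetI)
  \<comment> \<open>A point strictly between \<open>a\<close> and \<open>b\<close> is positive,
    hence interior to \<open>{0..}\<close>, where the derivative within the half-line is the
    ordinary one. At \<open>a\<close>, which may be 0, only continuity is used.\<close>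
  moreover have "(f has_derivative (*) (f' t)) (at t)" if "a < t" "t < b" for t
    using f[of t] that ab at_within_interior[of t "{0..}"]
    by (simp add: has_field_derivative_def)
  ultimately obtain \<xi> where "\<xi> \<in> {a<..<b}" "f b - f a = f' \<xi> * (b - a)"
    using mvt[OF ab(2), of f "\<lambda>t. (*) (f' t)"] by auto
  then show thesis using that by (auto simp: mult.commute)
qed

lemma halfline_continuous_on:
  fixes f f' :: "real \<Rightarrow> real"
  assumes "\<And>t. t \<ge> 0 \<Longrightarrow> (f has_real_derivative f' t) (at t within {0..})"
  shows "continuous_on {0..} f"
  using assms by (meson DERIV_continuous_on atLeast_iff)

lemma halfline_ge:
  fixes f f' :: "real \<Rightarrow> real"
  assumes f: "\<And>t. t \<ge> 0 \<Longrightarrow> (f has_real_derivative f' t) (at t within {0..})"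
    and ab: "0 \<le> a" "a \<le> b" and "\<And>t. a < t \<Longrightarrow> t < b \<Longrightarrow> c \<le> f' t"
  shows "f a + c * (b - a) \<le> f b"
proof (cases "a = b")
  case False
  then obtain \<xi> where "a < \<xi>" "\<xi> < b" "f b - f a = (b - a) * f' \<xi>"
    using ab f halfline_MVT[of a b f f'] by auto
  moreover have "(b - a) * c \<le> (b - a) * f' \<xi>"
    using ab calculation assms(4) by (intro mult_left_mono) auto
  ultimately show ?thesis by (simp add: algebra_simps)
qed auto

lemma halfline_le:
  fixes f f' :: "real \<Rightarrow> real"
  assumes f: "\<And>t. t \<ge> 0 \<Longrightarrow> (f has_real_derivative f' t) (at t within {0..})"
    and ab: "0 \<le> a" "a \<le> b" and c: "\<And>t. a < t \<Longrightarrow> t < b \<Longrightarrow> f' t \<le> c"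
  shows "f b \<le> f a + c * (b - a)"
proof -
  have "- f a + - c * (b - a) \<le> - f b"
    using c by (intro halfline_ge[OF DERIV_minus[OF f] ab]) auto
  then show ?thesis by simp
qed

lemma halfline_less:
  fixes f f' :: "real \<Rightarrow> real"
  assumes f: "\<And>t. t \<ge> 0 \<Longrightarrow> (f has_real_derivative f' t) (at t within {0..})"
    and ab: "0 \<le> a" "a < b" and "\<And>t. a < t \<Longrightarrow> t < b \<Longrightarrow> f' t < 0"
  shows "f b < f a"
proof -
  obtain \<xi> where "a < \<xi>" "\<xi> < b" "f b - f a = (b - a) * f' \<xi>"
    using ab f halfline_MVT[of a b f f'] by auto
  then show ?thesis using assms(4)[of \<xi>] ab by (smt (verit) mult_pos_neg)
qed

lemma first_zero:
  fixes g :: "real \<Rightarrow> real"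
  assumes "continuous_on {a..b} g" "a \<le> b" "g a < 0" "g b \<ge> 0"
  obtains \<sigma> where "a < \<sigma>" "\<sigma> \<le> b" "g \<sigma> = 0" "\<And>s. a \<le> s \<Longrightarrow> s < \<sigma> \<Longrightarrow> g s < 0"
proof -
  define Z where "Z = {s \<in> {a..b}. 0 \<le> g s}"
  have "closed Z" unfolding Z_def
    using continuous_closed_preimage[OF assms(1), of "{0..}"]
    by (simp add: vimage_def Int_def)
  have "b \<in> Z" using assms by (auto simp: Z_def)
  have bdd: "bdd_below Z" by (auto simp: Z_def intro: bdd_belowI[of _ a])
  define \<sigma> where "\<sigma> = Inf Z"
  have \<sigma>: "\<sigma> \<in> Z" unfolding \<sigma>_def
    using \<open>closed Z\<close> \<open>b \<in> Z\<close> bdd by (intro closed_contains_Inf) auto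
  have less: "g s < 0" if "a \<le> s" "s < \<sigma>" for s
  proof (rule ccontr)
    assume "\<not> g s < 0"
    with that \<sigma> have "s \<in> Z" by (auto simp: Z_def)
    then have "\<sigma> \<le> s" unfolding \<sigma>_def by (rule cInf_lower[OF _ bdd])
    with that show False by simp
  qed
  have "\<not> 0 < g \<sigma>"
  proof
    assume "0 < g \<sigma>"
    then obtain s where "a \<le> s" "s \<le> \<sigma>" "g s = 0"
      using IVT'[of g a 0 \<sigma>] assms(3) \<sigma> continuous_on_subset[OF assms(1), of "{a..\<sigma>}"]
      by (auto simp: Z_def)
    then show False using less[of s] \<open>0 < g \<sigma>\<close> by (cases "s = \<sigma>") auto
  qed
  then have "g \<sigma> = 0" using \<sigma> by (simp add: Z_def)
  moreover have "a < \<sigma>" using \<sigma> assms(3) calculation by (cases "a = \<sigma>") (auto simp: Z_def)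
  ultimately show thesis using \<sigma> by (intro that[OF _ _ _ less]) (auto simp: Z_def)
qed

text \<open>Counterpart of \<open>first_zero\<close> for a weak inequality: \<open>g\<close> may
  touch 0 and turn negative again, so the time wanted is the infimum of the times with
  \<open>g > 0\<close>. Since \<open>g\<close> is nonpositive at that infimum, positive values are
  only found arbitrarily soon after it.\<close>

lemma last_nonpos:
  fixes g :: "real \<Rightarrow> real"
  assumes cont: "continuous_on {a..b} g" and "a \<le> b" "g a \<le> 0" "g b > 0"
  obtains \<sigma> where "a \<le> \<sigma>" "\<And>s. a \<le> s \<Longrightarrow> s \<le> \<sigma> \<Longrightarrow> g s \<le> 0"
    "\<And>e. e > 0 \<Longrightarrow> \<exists>s. \<sigma> < s \<and> s < \<sigma> + e \<and> g s > 0"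
proof -
  define Z where "Z = {s \<in> {a..b}. 0 < g s}"
  have "b \<in> Z" using assms by (auto simp: Z_def)
  have bdd: "bdd_below Z" by (auto simp: Z_def intro: bdd_belowI[of _ a])
  define \<sigma> where "\<sigma> = Inf Z"
  have \<sigma>: "a \<le> \<sigma>" "\<sigma> \<le> b"
    using \<open>b \<in> Z\<close> bdd by (auto simp: \<sigma>_def Z_def intro: cInf_greatest cInf_lower)
  have less: "g s \<le> 0" if "a \<le> s" "s < \<sigma>" for s
  proof (rule ccontr)
    assume "\<not> g s \<le> 0"
    with that \<sigma> have "s \<in> Z" by (auto simp: Z_def)
    then have "\<sigma> \<le> s" unfolding \<sigma>_def by (rule cInf_lower[OF _ bdd])
    with that show False by simp
  qed
  have "g \<sigma> \<le> 0"
  proof (rule ccontr)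
    assume "\<not> g \<sigma> \<le> 0"
    then obtain s where s: "a \<le> s" "s \<le> \<sigma>" "g s = g \<sigma> / 2"
      using IVT'[of g a "g \<sigma> / 2" \<sigma>] assms(3) \<sigma> continuous_on_subset[OF cont, of "{a..\<sigma>}"]
      by auto
    then show False using less[of s] \<open>\<not> g \<sigma> \<le> 0\<close> by (cases "s = \<sigma>") auto
  qed
  show thesis
  proof (rule that[of \<sigma>])
    show "g s \<le> 0" if "a \<le> s" "s \<le> \<sigma>" for s
      using that less[of s] \<open>g \<sigma> \<le> 0\<close> by (cases "s = \<sigma>") auto
    show "\<exists>s. \<sigma> < s \<and> s < \<sigma> + e \<and> g s > 0" if e: "e > 0" for e
    proof -
      have "\<exists>s\<in>Z. s < \<sigma> + e"
        using cInf_less_iff[of Z "\<sigma> + e"] \<open>b \<in> Z\<close> bdd e by (auto simp: \<sigma>_def)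
      then obtain s where s: "s \<in> Z" "s < \<sigma> + e" by auto
      then have "\<sigma> \<le> s" unfolding \<sigma>_def by (intro cInf_lower bdd)
      moreover have "s \<noteq> \<sigma>" using s \<open>g \<sigma> \<le> 0\<close> by (auto simp: Z_def)
      ultimately show ?thesis using s by (auto simp: Z_def intro!: exI[of _ s])
    qed
  qed (rule \<sigma>)
qed

text \<open>Integrating factor: up to the first zero of \<open>z\<close> the product of
  \<open>z\<close> with exp(B t) does not increase, so it cannot climb from \<open>z 0 < 0\<close>
  to 0. This is why the inequality is demanded only where \<open>z \<le> 0\<close>.\<close>

lemma linear_ineq_stays_negative:
  fixes z z' :: "real \<Rightarrow> real"
  assumes z: "\<And>t. t \<ge> 0 \<Longrightarrow> (z has_real_derivative z' t) (at t within {0..})"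
    and z0: "z 0 < 0"
    and le: "\<And>t. 0 \<le> t \<Longrightarrow> t < T \<Longrightarrow> z t \<le> 0 \<Longrightarrow> z' t \<le> - B * z t"
    and t: "0 \<le> t" "t \<le> T"
  shows "z t < 0"
proof (rule ccontr)
  assume "\<not> z t < 0"
  then have zt: "0 \<le> z t" by simp
  have "continuous_on {0..t} z"
    by (rule continuous_on_subset[OF halfline_continuous_on[OF z]]) auto
  from first_zero[OF this t(1) z0 zt] obtain \<sigma> where \<sigma>: "0 < \<sigma>" "\<sigma> \<le> t" "z \<sigma> = 0"
    "\<And>s. 0 \<le> s \<Longrightarrow> s < \<sigma> \<Longrightarrow> z s < 0" by blast
  have "z \<sigma> * exp (B * \<sigma>) \<le> z 0 * exp (B * 0) + 0 * (\<sigma> - 0)"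
  proof (rule halfline_le)
    show "((\<lambda>s. z s * exp (B * s)) has_real_derivative (z' s + B * z s) * exp (B * s)) (at s within {0..})"
      if "s \<ge> 0" for s
      by (rule derivative_eq_intros z[OF that] refl)+ (simp add: distrib_right)
    show "(z' s + B * z s) * exp (B * s) \<le> 0" if "0 < s" "s < \<sigma>" for s
      using le[of s] \<sigma>(4)[of s] \<sigma>(2) t that by (auto intro: mult_nonpos_nonneg)
  qed (use \<sigma> in auto)
  then show False using \<sigma> z0 by simp
qed

section \<open>Globally Lipschitz differential equations\<close>

text \<open>The fixed point is sought among bounded continuous functions on the whole time axis. As
  \<open>L\<close> is a global constant, one application of Banach's theorem suffices and no local
  solutions have to be glued.\<close>

lemma lipschitz_ode_exists:
  fixes F :: "'a::banach \<Rightarrow> 'a"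
  assumes L: "L > 0" and lip: "\<And>x y. norm (F x - F y) \<le> L * norm (x - y)"
  shows "\<exists>X. X 0 = x0 \<and> (\<forall>t\<ge>0. (X has_vector_derivative F (X t)) (at t within {0..}))"
proof -
  have contF: "continuous_on UNIV F"
  proof -
    have "L-lipschitz_on UNIV F"
      using L lip by (auto simp: lipschitz_on_def dist_norm)
    then show ?thesis by (rule lipschitz_on_continuous_on)
  qed
  have contI: "continuous_on UNIV (\<lambda>s. F (exp (2*L * s) *\<^sub>R apply_bcontfun u s))" for u
    by (intro continuous_on_compose2[OF contF] continuous_intros) auto
  then have intI: "(\<lambda>s. F (exp (2*L * s) *\<^sub>R apply_bcontfun u s)) integrable_on {0..t}" for u t
    by (meson continuous_on_subset integrable_continuous_interval top_greatest)
  have exp_int: "((\<lambda>s. C * exp (2*L * s)) has_integral C * (exp (2*L*t) - 1) / (2*L)) {0..t}"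
    if "t \<ge> 0" for C t :: real
  proof -
    have "((\<lambda>s. C * exp (2*L * s)) has_integral
            C * exp (2*L*t) / (2*L) - C * exp (2*L*0) / (2*L)) {0..t}"
      using L that by (intro fundamental_theorem_of_calculus)
        (auto intro!: derivative_eq_intros simp: has_real_derivative_iff_has_vector_derivative[symmetric])
    then show ?thesis by (simp add: right_diff_distrib diff_divide_distrib)
  qed
  \<comment> \<open>The source of the contraction factor: the weight has rate \<open>2 * L\<close>,
    so with \<open>C = L * dist u v\<close> the right-hand side is half of
    \<open>dist u v\<close>.\<close>
  have exp_bound: "exp (-(2*L*t)) * (C * (exp (2*L*t) - 1) / (2*L)) \<le> C / (2*L)"
    if "t \<ge> 0" "C \<ge> 0" for C t :: real
  proof -
    have "exp (-(2*L*t)) * (exp (2*L*t) - 1) \<le> 1"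
      by (simp add: right_diff_distrib mult_exp_exp)
    then have "C / (2*L) * (exp (-(2*L*t)) * (exp (2*L*t) - 1)) \<le> C / (2*L)"
      using that L by (intro mult_left_le) auto
    then show ?thesis by (simp add: ac_simps)
  qed
  define J where "J u t = integral {0..t} (\<lambda>s. F (exp (2*L * s) *\<^sub>R apply_bcontfun u s))" for u t
  have J_deriv: "(J u has_vector_derivative F (exp (2*L*t) *\<^sub>R apply_bcontfun u t)) (at t within {0..})"
    if "t \<ge> 0" for u t
  proof -
    have "(J u has_vector_derivative F (exp (2*L*t) *\<^sub>R apply_bcontfun u t)) (at t within {0..t+1})"
      unfolding J_def using that
      by (intro integral_has_vector_derivative continuous_on_subset[OF contI]) auto
    moreover have "at t within {0..t+1} = at t within {0..}"
      by (rule at_within_nhd[of _ "{..<t+1}"]) (use that in auto)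
    ultimately show ?thesis by simp
  qed
  have contJ: "continuous_on {0..} (J u)" for u
    using J_deriv by (intro continuous_on_vector_derivative) auto
  \<comment> \<open>The Picard operator acting on \<open>u(t) = exp (- 2 L t) X(t)\<close>: with this weight it is a contraction on the
    whole half-line.\<close>
  define T where "T u t = exp (-(2*L*max t 0)) *\<^sub>R (x0 + J u (max t 0))" for u t
  \<comment> \<open>\<open>bcontfun\<close> consists of functions on all of the reals;
    \<open>max t 0\<close> in \<open>T\<close> extends the image to negative times by its value at
    0.\<close>
  have contT: "continuous_on UNIV (T u)" for u
    unfolding T_def by (intro continuous_intros continuous_on_compose2[OF contJ]) auto
  have T_bound: "norm (T u t) \<le> norm x0 + (norm (F 0) + L * norm u) / (2*L)" for u t
  proof -
    define r where "r = max t 0"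
    have r: "r \<ge> 0" by (simp add: r_def)
    define C where "C = norm (F 0) + L * norm u"
    have C: "C \<ge> 0" using L by (simp add: C_def)
    have "norm (F (exp (2*L * s) *\<^sub>R apply_bcontfun u s)) \<le> C * exp (2*L * s)" if "s \<in> {0..r}" for s
    proof -
      have "norm (F (exp (2*L * s) *\<^sub>R apply_bcontfun u s))
          \<le> norm (F 0) + L * norm (exp (2*L * s) *\<^sub>R apply_bcontfun u s)"
        using lip[of "exp (2*L * s) *\<^sub>R apply_bcontfun u s" 0]
          norm_triangle_sub[of "F (exp (2*L * s) *\<^sub>R apply_bcontfun u s)" "F 0"] by auto
      also have "\<dots> \<le> norm (F 0) * exp (2*L * s) + L * (exp (2*L * s) * norm u)"
      proof (rule add_mono)
        have "1 \<le> exp (2*L * s)" using L that by simp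
        from mult_left_mono[OF this, of "norm (F 0)"]
        show "norm (F 0) \<le> norm (F 0) * exp (2*L * s)" by simp
        show "L * norm (exp (2*L * s) *\<^sub>R apply_bcontfun u s) \<le> L * (exp (2*L * s) * norm u)"
          using L norm_bounded[of u s] by simp
      qed
      also have "\<dots> = C * exp (2*L * s)"
        by (simp add: C_def distrib_right mult_ac)
      finally show ?thesis .
    qed
    then have "norm (J u r) \<le> integral {0..r} (\<lambda>s. C * exp (2*L * s))"
      unfolding J_def using exp_int[OF r]
      by (intro integral_norm_bound_integral intI) (auto simp: has_integral_integrable)
    also have "\<dots> = C * (exp (2*L*r) - 1) / (2*L)"
      using exp_int[OF r] by (rule integral_unique)
    finally have J: "norm (J u r) \<le> C * (exp (2*L*r) - 1) / (2*L)" .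
    have "norm (T u t) \<le> exp (-(2*L*r)) * (norm x0 + norm (J u r))"
      by (simp add: T_def r_def[symmetric] norm_triangle_ineq)
    also have "\<dots> \<le> 1 * norm x0 + exp (-(2*L*r)) * (C * (exp (2*L*r) - 1) / (2*L))"
      unfolding distrib_left using r L J by (intro add_mono mult_left_mono mult_right_mono) auto
    also have "\<dots> \<le> norm x0 + C / (2*L)"
      using exp_bound[OF r C] by simp
    finally show ?thesis by (simp add: C_def)
  qed
  have T_bc: "T u \<in> bcontfun" for u
    using contT[of u] T_bound[of u] by (intro bcontfun_normI) auto
  define S where "S u = Bcontfun (T u)" for u
  have S: "apply_bcontfun (S u) = T u" for u
    by (simp add: S_def Bcontfun_inverse T_bc)
  have contr: "dist (S u) (S v) \<le> (1/2) * dist u v" for u v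
  proof (rule dist_bound)
    fix t :: real
    define r where "r = max t 0"
    have r: "r \<ge> 0" by (simp add: r_def)
    define C where "C = L * dist u v"
    have C: "C \<ge> 0" using L by (simp add: C_def)
    have "norm (F (exp (2*L * s) *\<^sub>R apply_bcontfun u s) - F (exp (2*L * s) *\<^sub>R apply_bcontfun v s))
        \<le> C * exp (2*L * s)" for s
    proof -
      have "norm (exp (2*L * s) *\<^sub>R apply_bcontfun u s - exp (2*L * s) *\<^sub>R apply_bcontfun v s)
          = exp (2*L * s) * dist (apply_bcontfun u s) (apply_bcontfun v s)"
        by (simp only: scaleR_diff_right[symmetric] dist_norm norm_scaleR abs_exp_cancel)
      also have "\<dots> \<le> exp (2*L * s) * dist u v"
        using dist_bounded by (intro mult_left_mono) auto
      finally have "L * norm (exp (2*L * s) *\<^sub>R apply_bcontfun u s - exp (2*L * s) *\<^sub>R apply_bcontfun v s)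
          \<le> L * (exp (2*L * s) * dist u v)"
        using L by (intro mult_left_mono) auto
      then show ?thesis
        using lip[of "exp (2*L * s) *\<^sub>R apply_bcontfun u s" "exp (2*L * s) *\<^sub>R apply_bcontfun v s"]
        by (simp add: C_def mult_ac)
    qed
    then have "norm (J u r - J v r) \<le> integral {0..r} (\<lambda>s. C * exp (2*L * s))"
      unfolding J_def using exp_int[OF r]
      by (subst integral_diff[symmetric, OF intI intI])
        (intro integral_norm_bound_integral integrable_diff intI, auto simp: has_integral_integrable)
    also have "\<dots> = C * (exp (2*L*r) - 1) / (2*L)"
      using exp_int[OF r] by (rule integral_unique)
    finally have J: "norm (J u r - J v r) \<le> C * (exp (2*L*r) - 1) / (2*L)" .
    have "dist (S u t) (S v t) = exp (-(2*L*r)) * norm (J u r - J v r)"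
      by (simp only: S T_def r_def[symmetric] dist_norm scaleR_diff_right[symmetric] norm_scaleR
          abs_exp_cancel add_diff_cancel_left)
    also have "\<dots> \<le> exp (-(2*L*r)) * (C * (exp (2*L*r) - 1) / (2*L))"
      using J by (intro mult_left_mono) auto
    also have "\<dots> \<le> C / (2*L)" by (rule exp_bound[OF r C])
    finally show "dist (S u t) (S v t) \<le> (1/2) * dist u v"
      using L by (simp add: C_def)
  qed
  have "\<exists>!u. S u = u"
    using contr by (intro banach_fix_type[of "1/2"]) auto
  then obtain u where u: "S u = u" by auto
  define X where "X t = exp (2*L*t) *\<^sub>R apply_bcontfun u t" for t
  have X: "X t = x0 + J u t" if "t \<ge> 0" for t
  proof -
    have "apply_bcontfun u t = T u t" using S[of u] u by simp
    then show ?thesis using that by (simp add: X_def T_def exp_minus)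
  qed
  have "(X has_vector_derivative F (X t)) (at t within {0..})" if "t \<ge> 0" for t
  proof (rule has_vector_derivative_transform)
    show "((\<lambda>t. x0 + J u t) has_vector_derivative F (X t)) (at t within {0..})"
      using J_deriv[OF that, of u] by (auto intro!: derivative_eq_intros simp: X_def)
  qed (use that X in auto)
  moreover have "X 0 = x0" using X[of 0] by (simp add: J_def)
  ultimately show ?thesis by blast
qed

text \<open>By Cauchy-Schwarz the squared distance weighted by exp(-2 L t) does not increase. The
  square, available in an inner product space, is differentiable also at times where the two
  solutions meet.\<close>

lemma lipschitz_ode_dist:
  fixes F :: "'a::real_inner \<Rightarrow> 'a"
  assumes lip: "\<And>x y. norm (F x - F y) \<le> L * norm (x - y)"
    and X: "\<And>t. t \<ge> 0 \<Longrightarrow> (X has_vector_derivative F (X t)) (at t within {0..})"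
    and Y: "\<And>t. t \<ge> 0 \<Longrightarrow> (Y has_vector_derivative F (Y t)) (at t within {0..})"
    and t: "t \<ge> 0"
  shows "norm (X t - Y t) \<le> exp (L * t) * norm (X 0 - Y 0)"
proof -
  define h where "h s = exp (-(2*L * s)) * ((X s - Y s) \<bullet> (X s - Y s))" for s
  define h' where "h' s = exp (-(2*L * s)) * (2 * ((X s - Y s) \<bullet> (F (X s) - F (Y s))))
      - 2*L*exp (-(2*L * s)) * ((X s - Y s) \<bullet> (X s - Y s))" for s
  have h': "(h has_real_derivative h' s) (at s within {0..})" if "s \<ge> 0" for s
  proof -
    have "((\<lambda>s. X s - Y s) has_vector_derivative F (X s) - F (Y s)) (at s within {0..})"
      by (intro has_vector_derivative_diff X Y that)
    from has_derivative_inner[OF this[unfolded has_vector_derivative_def]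
        this[unfolded has_vector_derivative_def]]
    have "((\<lambda>s. (X s - Y s) \<bullet> (X s - Y s)) has_real_derivative
        2 * ((X s - Y s) \<bullet> (F (X s) - F (Y s)))) (at s within {0..})"
      unfolding has_field_derivative_def
      by (rule has_derivative_eq_rhs) (auto simp: inner_commute algebra_simps)
    then show ?thesis
      unfolding h_def h'_def by (auto intro!: derivative_eq_intros)
  qed
  have neg: "h' s \<le> 0" for s
  proof -
    have "(X s - Y s) \<bullet> (F (X s) - F (Y s)) \<le> norm (X s - Y s) * norm (F (X s) - F (Y s))"
      by (rule norm_cauchy_schwarz)
    also have "\<dots> \<le> norm (X s - Y s) * (L * norm (X s - Y s))"
      using lip by (intro mult_left_mono) auto
    also have "\<dots> = L * ((X s - Y s) \<bullet> (X s - Y s))"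
      by (simp add: power2_norm_eq_inner[symmetric] power2_eq_square)
    finally have "exp (-(2*L * s)) * (2 * ((X s - Y s) \<bullet> (F (X s) - F (Y s))))
        \<le> exp (-(2*L * s)) * (2 * (L * ((X s - Y s) \<bullet> (X s - Y s))))"
      by (intro mult_left_mono) auto
    then show ?thesis by (simp add: h'_def algebra_simps)
  qed
  have "h t \<le> h 0"
  proof (cases "t = 0")
    case False
    with t obtain \<xi> where "h t - h 0 = (t - 0) * h' \<xi>"
      using halfline_MVT[of 0 t h h'] h' by auto
    then show ?thesis using neg[of \<xi>] t by (smt (verit) mult_nonneg_nonpos)
  qed auto
  then have "exp (-(2 * L * t)) * (norm (X t - Y t))\<^sup>2 \<le> (norm (X 0 - Y 0))\<^sup>2"
    by (simp add: h_def power2_norm_eq_inner)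
  then have "exp (2 * L * t) * (exp (-(2 * L * t)) * (norm (X t - Y t))\<^sup>2)
      \<le> exp (2 * L * t) * (norm (X 0 - Y 0))\<^sup>2"
    by (intro mult_left_mono) auto
  also have "exp (2 * L * t) = (exp (L * t))\<^sup>2"
    by (simp add: exp_double[symmetric] mult.assoc)
  also have "(exp (L * t))\<^sup>2 * (exp (-(2 * L * t)) * (norm (X t - Y t))\<^sup>2) = (norm (X t - Y t))\<^sup>2"
    by (simp add: mult.assoc[symmetric] mult_exp_exp power2_eq_square)
  finally have "(norm (X t - Y t))\<^sup>2 \<le> (exp (L * t) * norm (X 0 - Y 0))\<^sup>2"
    by (simp add: power_mult_distrib)
  then show ?thesis by (rule power2_le_imp_le) auto
qed

section \<open>The truncated system\<close>

definition clip :: "real \<Rightarrow> real \<Rightarrow> real \<Rightarrow> real" where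
  "clip l h x = max l (min h x)"

lemma clip_lipschitz: "\<bar>clip l h x - clip l h y\<bar> \<le> \<bar>x - y\<bar>"
  by (auto simp: clip_def max_def min_def)

lemma clip_id: "l \<le> x \<Longrightarrow> x \<le> h \<Longrightarrow> clip l h x = x"
  by (simp add: clip_def)

lemma clip_abs_le: "0 \<le> M \<Longrightarrow> \<bar>clip (- M) M x\<bar> \<le> M"
  by (auto simp: clip_def max_def min_def)

lemma clip_abs_le_abs: "0 \<le> M \<Longrightarrow> \<bar>clip (- M) M x\<bar> \<le> \<bar>x\<bar>"
  by (auto simp: clip_def max_def min_def)

lemma abs_square_diff_le:
  fixes u v :: real
  assumes "\<bar>u\<bar> \<le> K" "\<bar>v\<bar> \<le> K"
  shows "\<bar>u\<^sup>2 - v\<^sup>2\<bar> \<le> 2 * K * \<bar>u - v\<bar>"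
proof -
  have "\<bar>u\<^sup>2 - v\<^sup>2\<bar> = \<bar>u + v\<bar> * \<bar>u - v\<bar>"
    by (simp add: power2_eq_square square_diff_square_factored abs_mult)
  also have "\<dots> \<le> (2 * K) * \<bar>u - v\<bar>"
    using assms by (intro mult_right_mono) auto
  finally show ?thesis .
qed

lemma norm_triple:
  fixes x w e :: real
  shows "\<bar>x\<bar> \<le> norm (x, w, e)" "\<bar>w\<bar> \<le> norm (x, w, e)" "\<bar>e\<bar> \<le> norm (x, w, e)"
    "norm (x, w, e) \<le> \<bar>x\<bar> + \<bar>w\<bar> + \<bar>e\<bar>"
proof -
  have 1: "norm x \<le> norm (x, w, e)" "norm (w, e) \<le> norm (x, w, e)"
    "norm w \<le> norm (w, e)" "norm e \<le> norm (w, e)"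
    by (rule norm_fst_le norm_snd_le)+
  have 2: "norm (x, w, e) \<le> norm x + norm (w, e)" "norm (w, e) \<le> norm w + norm e"
    by (rule norm_Pair_le)+
  show "\<bar>x\<bar> \<le> norm (x, w, e)" "\<bar>w\<bar> \<le> norm (x, w, e)" "\<bar>e\<bar> \<le> norm (x, w, e)"
    "norm (x, w, e) \<le> \<bar>x\<bar> + \<bar>w\<bar> + \<bar>e\<bar>"
    using 1 2 unfolding real_norm_def by linarith+
qed

text \<open>The state is \<open>(x, w, e) = (f, f' + a/2 f\<^sup>2, f'' + a f f')\<close>. The bounds that a bounded solution satisfies
  involve \<open>x\<close> and \<open>f'\<close> only, so clipping these two makes the field globally Lipschitz.\<close>

definition slope :: "real \<Rightarrow> real \<Rightarrow> real \<Rightarrow> real \<Rightarrow> real" where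
  "slope a M x w = w - a / 2 * (clip (- M) M x)\<^sup>2"

definition field :: "real \<Rightarrow> real \<Rightarrow> real \<Rightarrow> real \<Rightarrow> real \<times> real \<times> real \<Rightarrow> real \<times> real \<times> real" where
  "field a b M Y = (\<lambda>(x, w, e). (slope a M x w, e, b * (clip 0 Y (slope a M x w))\<^sup>2))"

text \<open>A square is Lipschitz only on bounded sets; both squares in \<open>field\<close> are
  taken of clipped quantities, bounded by \<open>M\<close> and \<open>Y\<close>. Here
  \<open>1 + a * M\<close> is the Lipschitz constant of \<open>slope\<close>, and the last component
  multiplies it by \<open>2 * b * Y\<close>.\<close>

lemma field_lipschitz:
  assumes "0 \<le> a" "0 \<le> b" "0 \<le> M" "0 \<le> Y"
  shows "\<exists>L>0. \<forall>p q. norm (field a b M Y p - field a b M Y q) \<le> L * norm (p - q)"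
proof -
  define C where "C = 1 + a * M"
  have C: "C \<ge> 0" using assms by (simp add: C_def)
  have "norm (field a b M Y p - field a b M Y q) \<le> (C + 1 + b * (2 * Y * C)) * norm (p - q)" for p q
  proof -
    obtain x w e x' w' e' where pq: "p = (x, w, e)" "q = (x', w', e')"
      by (metis prod_cases3)
    define n where "n = norm (p - q)"
    have x: "\<bar>x - x'\<bar> \<le> n" and w: "\<bar>w - w'\<bar> \<le> n" and e: "\<bar>e - e'\<bar> \<le> n"
      using norm_triple(1-3)[where x = "x - x'" and w = "w - w'" and e = "e - e'"] by (simp_all add: pq n_def)
    define s s' where "s = slope a M x w" and "s' = slope a M x' w'"
    have "\<bar>(clip (-M) M x)\<^sup>2 - (clip (-M) M x')\<^sup>2\<bar> \<le> 2 * M * \<bar>clip (-M) M x - clip (-M) M x'\<bar>"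
      using assms by (intro abs_square_diff_le clip_abs_le)
    also have "\<dots> \<le> 2 * M * n"
      using assms x clip_lipschitz[of "-M" M x x'] by (intro mult_left_mono) auto
    finally have "a / 2 * \<bar>(clip (-M) M x)\<^sup>2 - (clip (-M) M x')\<^sup>2\<bar> \<le> a / 2 * (2 * M * n)"
      using assms by (intro mult_left_mono) auto
    then have "\<bar>a / 2 * (clip (-M) M x)\<^sup>2 - a / 2 * (clip (-M) M x')\<^sup>2\<bar> \<le> a * M * n"
      unfolding right_diff_distrib[symmetric] abs_mult using assms by simp
    moreover have "s - s' = (w - w') - (a / 2 * (clip (-M) M x)\<^sup>2 - a / 2 * (clip (-M) M x')\<^sup>2)"
      by (simp add: s_def s'_def slope_def)
    ultimately have s: "\<bar>s - s'\<bar> \<le> C * n"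
      using w by (simp add: C_def distrib_right)
    have "\<bar>(clip 0 Y s)\<^sup>2 - (clip 0 Y s')\<^sup>2\<bar> \<le> 2 * Y * \<bar>clip 0 Y s - clip 0 Y s'\<bar>"
      using assms by (intro abs_square_diff_le) (auto simp: clip_def)
    also have "\<dots> \<le> 2 * Y * (C * n)"
      using assms s clip_lipschitz[of 0 Y s s'] by (intro mult_left_mono) auto
    finally have "b * \<bar>(clip 0 Y s)\<^sup>2 - (clip 0 Y s')\<^sup>2\<bar> \<le> b * (2 * Y * (C * n))"
      using assms by (intro mult_left_mono) auto
    then have t: "\<bar>b * (clip 0 Y s)\<^sup>2 - b * (clip 0 Y s')\<^sup>2\<bar> \<le> b * (2 * Y * C) * n"
      unfolding right_diff_distrib[symmetric] abs_mult using assms by (simp add: mult.assoc)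
    have "norm (field a b M Y p - field a b M Y q)
        = norm (s - s', e - e', b * (clip 0 Y s)\<^sup>2 - b * (clip 0 Y s')\<^sup>2)"
      by (simp add: field_def pq s_def s'_def)
    also have "\<dots> \<le> \<bar>s - s'\<bar> + \<bar>e - e'\<bar> + \<bar>b * (clip 0 Y s)\<^sup>2 - b * (clip 0 Y s')\<^sup>2\<bar>"
      by (rule norm_triple(4))
    also have "\<dots> \<le> C * n + n + b * (2 * Y * C) * n"
      using s e t by (intro add_mono)
    finally show ?thesis by (simp add: n_def distrib_right)
  qed
  moreover have "C + 1 + b * (2 * Y * C) > 0"
    using C assms by (smt (verit) mult_nonneg_nonneg)
  ultimately show ?thesis by blast
qed

text \<open>Three real derivatives instead of one in the product type, because all later arguments
  apply the mean value theorem to single components; \<open>is_flow_iff\<close> gives the vector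
  form needed for existence and dependence.\<close>

definition is_flow :: "real \<Rightarrow> real \<Rightarrow> real \<Rightarrow> real \<Rightarrow> (real \<Rightarrow> real) \<Rightarrow> (real \<Rightarrow> real) \<Rightarrow> (real \<Rightarrow> real) \<Rightarrow> bool" where
  "is_flow a b M Y x w e \<longleftrightarrow> (\<forall>t\<ge>0.
     (x has_real_derivative slope a M (x t) (w t)) (at t within {0..}) \<and>
     (w has_real_derivative e t) (at t within {0..}) \<and>
     (e has_real_derivative b * (clip 0 Y (slope a M (x t) (w t)))\<^sup>2) (at t within {0..}))"

lemma has_vector_derivative_triple_iff:
  fixes x w e :: "real \<Rightarrow> real"
  shows "((\<lambda>t. (x t, w t, e t)) has_vector_derivative (x', w', e')) (at r within S) \<longleftrightarrow>
    (x has_vector_derivative x') (at r within S) \<and> (w has_vector_derivative w') (at r within S) \<and>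
    (e has_vector_derivative e') (at r within S)"
  (is "?L \<longleftrightarrow> ?R")
proof
  assume ?L
  then have L: "((\<lambda>t. (x t, w t, e t)) has_derivative (\<lambda>h. h *\<^sub>R (x', w', e'))) (at r within S)"
    by (simp add: has_vector_derivative_def)
  from has_derivative_fst[OF L] has_derivative_fst[OF has_derivative_snd[OF L]]
    has_derivative_snd[OF has_derivative_snd[OF L]]
  show ?R by (simp add: has_vector_derivative_def)
next
  assume ?R
  then show ?L
    by (auto simp: has_vector_derivative_def intro!: has_derivative_Pair)
qed

lemma is_flow_iff:
  "is_flow a b M Y x w e \<longleftrightarrow> (\<forall>t\<ge>0. ((\<lambda>t. (x t, w t, e t)) has_vector_derivative
     field a b M Y (x t, w t, e t)) (at t within {0..}))"
  by (simp add: is_flow_def field_def has_vector_derivative_triple_iff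
      has_real_derivative_iff_has_vector_derivative)

text \<open>One \<open>L\<close> serves all flows of the field, which yields both continuity in the
  shooting parameter and uniqueness for given initial data. The factor 3 arises from bounding each
  of the three components by the norm of the triple.\<close>

lemma flow_dist:
  assumes "0 \<le> a" "0 \<le> b" "0 \<le> M" "0 \<le> Y"
  shows "\<exists>L. \<forall>x w e x' w' e' t. is_flow a b M Y x w e \<longrightarrow> is_flow a b M Y x' w' e' \<longrightarrow> 0 \<le> t \<longrightarrow>
    \<bar>x t - x' t\<bar> + \<bar>w t - w' t\<bar> + \<bar>e t - e' t\<bar>
      \<le> 3 * exp (L * t) * (\<bar>x 0 - x' 0\<bar> + \<bar>w 0 - w' 0\<bar> + \<bar>e 0 - e' 0\<bar>)"
proof -
  obtain L where L: "\<And>p q. norm (field a b M Y p - field a b M Y q) \<le> L * norm (p - q)"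
    using field_lipschitz[OF assms] by blast
  show ?thesis
  proof (rule exI[of _ L], intro allI impI)
    fix x w e x' w' e' :: "real \<Rightarrow> real" and t :: real
    assume *: "is_flow a b M Y x w e" "is_flow a b M Y x' w' e'" "0 \<le> t"
    define n where "n = norm (x t - x' t, w t - w' t, e t - e' t)"
    define k where "k = norm (x 0 - x' 0, w 0 - w' 0, e 0 - e' 0)"
    have "n \<le> exp (L * t) * k"
      using lipschitz_ode_dist[of "field a b M Y" L "\<lambda>t. (x t, w t, e t)" "\<lambda>t. (x' t, w' t, e' t)" t] L *
      by (simp add: is_flow_iff n_def k_def)
    moreover have "k \<le> \<bar>x 0 - x' 0\<bar> + \<bar>w 0 - w' 0\<bar> + \<bar>e 0 - e' 0\<bar>"
      unfolding k_def by (rule norm_triple(4))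
    ultimately have "n \<le> exp (L * t) * (\<bar>x 0 - x' 0\<bar> + \<bar>w 0 - w' 0\<bar> + \<bar>e 0 - e' 0\<bar>)"
      by (smt (verit) exp_gt_zero mult_left_mono)
    then show "\<bar>x t - x' t\<bar> + \<bar>w t - w' t\<bar> + \<bar>e t - e' t\<bar>
      \<le> 3 * exp (L * t) * (\<bar>x 0 - x' 0\<bar> + \<bar>w 0 - w' 0\<bar> + \<bar>e 0 - e' 0\<bar>)"
      using norm_triple(1-3)[where x = "x t - x' t" and w = "w t - w' t" and e = "e t - e' t"]
      unfolding n_def[symmetric] by linarith
  qed
qed

lemma flow_exists:
  assumes "0 \<le> a" "0 \<le> b" "0 \<le> M" "0 \<le> Y"
  shows "\<exists>x w e. is_flow a b M Y x w e \<and> x 0 = x0 \<and> w 0 = w0 \<and> e 0 = e0"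
proof -
  obtain L where L: "L > 0" "\<And>p q. norm (field a b M Y p - field a b M Y q) \<le> L * norm (p - q)"
    using field_lipschitz[OF assms] by blast
  obtain X where X: "X 0 = (x0, w0, e0)"
    "\<And>t. t \<ge> 0 \<Longrightarrow> (X has_vector_derivative field a b M Y (X t)) (at t within {0..})"
    using lipschitz_ode_exists[OF L, of "(x0, w0, e0)"] by auto
  then show ?thesis
    by (intro exI[of _ "\<lambda>t. fst (X t)"] exI[of _ "\<lambda>t. fst (snd (X t))"]
        exI[of _ "\<lambda>t. snd (snd (X t))"]) (simp add: is_flow_iff)
qed

section \<open>Shooting\<close>

lemma abs_le_imp_continuous:
  fixes f :: "real \<Rightarrow> real"
  assumes "\<And>\<alpha> \<beta>. \<bar>f \<alpha> - f \<beta>\<bar> \<le> C * \<bar>\<alpha> - \<beta>\<bar>" "C \<ge> 0"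
  shows "continuous_on UNIV f"
  by (rule lipschitz_on_continuous_on[of C]) (use assms in \<open>auto simp: lipschitz_on_def dist_real_def\<close>)

text \<open>One global truncated flow for each initial slope \<alpha>; \<open>init\<close>
  translates f(0) = -\<gamma>, f'(0) = \<alpha>, f''(0) = -1 into the state variables.
  \<open>MY\<close> ties the two cut-offs together: w <= Y and f' >= 0 force |f| <= M, and the
  square subtracted in \<open>slope\<close> never exceeds Y + 1.\<close>

locale shooting =
  fixes a b \<gamma> M Y :: real and X W E :: "real \<Rightarrow> real \<Rightarrow> real"
  assumes a: "0 < a" and b: "0 < b" "b \<le> a" and M: "0 \<le> M" and Y: "0 \<le> Y" and MY: "a / 2 * M\<^sup>2 = Y + 1"
    and flow: "\<And>\<alpha>. is_flow a b M Y (X \<alpha>) (W \<alpha>) (E \<alpha>)"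
    and init: "\<And>\<alpha>. X \<alpha> 0 = - \<gamma>" "\<And>\<alpha>. W \<alpha> 0 = \<alpha> + a / 2 * \<gamma>\<^sup>2" "\<And>\<alpha>. E \<alpha> 0 = - 1 - a * \<gamma> * \<alpha>"
begin

text \<open>\<open>s\<close> is the true derivative of \<open>X\<close>, whereas \<open>y\<close>
  and \<open>z\<close> are the f' and f'' that the state would encode without clipping. The events
  are phrased with \<open>y\<close>; inside the region \<open>s\<close> and \<open>y\<close>
  agree.\<close>

definition s where "s \<alpha> t = slope a M (X \<alpha> t) (W \<alpha> t)"
definition y where "y \<alpha> t = W \<alpha> t - a / 2 * (X \<alpha> t)\<^sup>2"
definition z where "z \<alpha> t = E \<alpha> t - a * X \<alpha> t * y \<alpha> t"

lemma X': "t \<ge> 0 \<Longrightarrow> (X \<alpha> has_real_derivative s \<alpha> t) (at t within {0..})"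
  and W': "t \<ge> 0 \<Longrightarrow> (W \<alpha> has_real_derivative E \<alpha> t) (at t within {0..})"
  and E': "t \<ge> 0 \<Longrightarrow> (E \<alpha> has_real_derivative b * (clip 0 Y (s \<alpha> t))\<^sup>2) (at t within {0..})"
  using flow[of \<alpha>] by (auto simp: is_flow_def s_def)

lemma y': "t \<ge> 0 \<Longrightarrow> (y \<alpha> has_real_derivative E \<alpha> t - a * X \<alpha> t * s \<alpha> t) (at t within {0..})"
  unfolding y_def by (rule derivative_eq_intros X' W' refl | assumption)+ simp

lemma z': "t \<ge> 0 \<Longrightarrow> (z \<alpha> has_real_derivative b * (clip 0 Y (s \<alpha> t))\<^sup>2
    - a * s \<alpha> t * y \<alpha> t - a * X \<alpha> t * (E \<alpha> t - a * X \<alpha> t * s \<alpha> t)) (at t within {0..})"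
  unfolding z_def by (rule derivative_eq_intros X' E' y' refl | assumption)+ simp

lemma y0: "y \<alpha> 0 = \<alpha>" and z0: "z \<alpha> 0 = - 1"
  by (simp_all add: y_def z_def init)

lemma E_mono: "0 \<le> r \<Longrightarrow> r \<le> t \<Longrightarrow> E \<alpha> r \<le> E \<alpha> t"
  using halfline_ge[of "E \<alpha>" _ r t 0, OF E'] b by simp

definition phase where "phase \<alpha> T \<longleftrightarrow> (\<forall>t. 0 \<le> t \<longrightarrow> t \<le> T \<longrightarrow> 0 \<le> y \<alpha> t \<and> E \<alpha> t \<le> 0)"

text \<open>W' = E <= 0 gives W <= W(0) <= Y. Since W is the sum of the nonnegative terms y and a/2
  X^2, each of them is at most Y, so both clips are idle on the region.\<close>

lemma phase_bounds:
  assumes ph: "phase \<alpha> T" and \<alpha>: "\<alpha> + a / 2 * \<gamma>\<^sup>2 \<le> Y" and t: "0 \<le> t" "t \<le> T"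
  shows "\<bar>X \<alpha> t\<bar> \<le> M" "s \<alpha> t = y \<alpha> t" "clip 0 Y (s \<alpha> t) = y \<alpha> t"
    "a / 2 * (X \<alpha> t)\<^sup>2 \<le> \<alpha> + a / 2 * \<gamma>\<^sup>2"
proof -
  have "W \<alpha> t \<le> W \<alpha> 0 + 0 * (t - 0)"
    using t ph by (intro halfline_le[OF W']) (auto simp: phase_def)
  then have W: "W \<alpha> t \<le> \<alpha> + a / 2 * \<gamma>\<^sup>2" by (simp add: init)
  have y: "0 \<le> y \<alpha> t" using ph t by (auto simp: phase_def)
  show x2: "a / 2 * (X \<alpha> t)\<^sup>2 \<le> \<alpha> + a / 2 * \<gamma>\<^sup>2"
    using W y by (simp add: y_def)
  then have "a / 2 * (X \<alpha> t)\<^sup>2 \<le> a / 2 * M\<^sup>2" using \<alpha> MY by linarith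
  then show x: "\<bar>X \<alpha> t\<bar> \<le> M"
    using a M by (simp add: power2_le_iff_abs_le)
  then show "s \<alpha> t = y \<alpha> t" unfolding s_def y_def slope_def by (subst clip_id) auto
  moreover have "y \<alpha> t \<le> W \<alpha> t" using a by (simp add: y_def)
  ultimately show "clip 0 Y (s \<alpha> t) = y \<alpha> t"
    using y W \<alpha> by (auto intro!: clip_id)
qed

text \<open>With the clips idle, z' = - a X z - (a - b) y^2, and b <= a makes the last term
  nonpositive.\<close>

lemma phase_z_neg:
  assumes ph: "phase \<alpha> T" and \<alpha>: "\<alpha> + a / 2 * \<gamma>\<^sup>2 \<le> Y" and t: "0 \<le> t" "t \<le> T"
  shows "z \<alpha> t < 0"
proof (rule linear_ineq_stays_negative[OF z'])
  fix r assume r: "0 \<le> r" "r < T" "z \<alpha> r \<le> 0"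
  note P = phase_bounds[OF ph \<alpha> r(1) less_imp_le[OF r(2)]]
  \<comment> \<open>Because z <= 0, replacing X by its lower bound -M or upper bound M can be
    compared: the constant rate \<open>a * M\<close> dominates the variable coefficient.\<close>
  have "- (a * X \<alpha> r) * z \<alpha> r \<le> - (a * M) * z \<alpha> r"
    using P(1) r(3) a by (intro mult_right_mono_neg) auto
  moreover have "(b - a) * (y \<alpha> r)\<^sup>2 \<le> 0" using b by (simp add: mult_nonpos_nonneg)
  ultimately show "b * (clip 0 Y (s \<alpha> r))\<^sup>2 - a * s \<alpha> r * y \<alpha> r
      - a * X \<alpha> r * (E \<alpha> r - a * X \<alpha> r * s \<alpha> r) \<le> - (a * M) * z \<alpha> r"
    unfolding P(3) unfolding P(2) by (simp add: z_def power2_eq_square left_diff_distrib)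
qed (use t z0 in auto)

text \<open>Strict inequalities make both events open in \<alpha>. Only \<open>B\<close> records the
  past of the trajectory: E is nondecreasing, so E < 0 at one time, as in \<open>A\<close>, already
  implies it at all earlier times. The same monotonicity excludes an \<open>A\<close>-time after a
  \<open>B\<close>-time, and the positivity recorded in \<open>B\<close> excludes one before
  it.\<close>

definition A where "A = {\<alpha>. \<exists>t\<ge>0. y \<alpha> t < 0 \<and> E \<alpha> t < 0}"
definition B where "B = {\<alpha>. \<exists>t\<ge>0. E \<alpha> t > 0 \<and> (\<forall>r. 0 \<le> r \<longrightarrow> r \<le> t \<longrightarrow> 0 < y \<alpha> r)}"

lemma A_Int_B: "A \<inter> B = {}"
proof -
  have False if t: "0 \<le> t" "y \<alpha> t < 0" "E \<alpha> t < 0"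
    and u: "0 \<le> u" "E \<alpha> u > 0" "\<forall>r. 0 \<le> r \<longrightarrow> r \<le> u \<longrightarrow> 0 < y \<alpha> r" for \<alpha> t u
  proof (cases "t \<le> u")
    case True with t u show False by force
  next
    case False with t u E_mono[of u t \<alpha>] show False by simp
  qed
  then show ?thesis unfolding A_def B_def by blast
qed

lemma dependence:
  obtains C where "\<And>\<alpha> \<beta> t. 0 \<le> t \<Longrightarrow> t \<le> T \<Longrightarrow> \<bar>X \<alpha> t - X \<beta> t\<bar> \<le> C * \<bar>\<alpha> - \<beta>\<bar>"
    "\<And>\<alpha> \<beta> t. 0 \<le> t \<Longrightarrow> t \<le> T \<Longrightarrow> \<bar>W \<alpha> t - W \<beta> t\<bar> \<le> C * \<bar>\<alpha> - \<beta>\<bar>"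
    "\<And>\<alpha> \<beta> t. 0 \<le> t \<Longrightarrow> t \<le> T \<Longrightarrow> \<bar>E \<alpha> t - E \<beta> t\<bar> \<le> C * \<bar>\<alpha> - \<beta>\<bar>" "C \<ge> 0"
proof -
  obtain L where L: "\<forall>x w e x' w' e' t. is_flow a b M Y x w e \<longrightarrow> is_flow a b M Y x' w' e' \<longrightarrow> 0 \<le> t \<longrightarrow>
    \<bar>x t - x' t\<bar> + \<bar>w t - w' t\<bar> + \<bar>e t - e' t\<bar>
      \<le> 3 * exp (L * t) * (\<bar>x 0 - x' 0\<bar> + \<bar>w 0 - w' 0\<bar> + \<bar>e 0 - e' 0\<bar>)"
    using flow_dist[of a b M Y] a b M Y by auto
  \<comment> \<open>The last factor measures the initial data: W(0) varies with \<alpha> at rate 1,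
    E(0) at rate - a \<gamma>, X(0) not at all. Passing to \<open>\<bar>L\<bar> * T\<close> makes
    the bound uniform in time whatever the sign of \<open>L\<close>.\<close>
  define C where "C = 3 * exp (\<bar>L\<bar> * T) * (1 + a * \<bar>\<gamma>\<bar>)"
  have sum: "\<bar>X \<alpha> t - X \<beta> t\<bar> + \<bar>W \<alpha> t - W \<beta> t\<bar> + \<bar>E \<alpha> t - E \<beta> t\<bar> \<le> C * \<bar>\<alpha> - \<beta>\<bar>"
    if t: "0 \<le> t" "t \<le> T" for \<alpha> \<beta> t
  proof -
    have "E \<alpha> 0 - E \<beta> 0 = a * \<gamma> * (\<beta> - \<alpha>)" by (simp add: init algebra_simps)
    then have "\<bar>E \<alpha> 0 - E \<beta> 0\<bar> = a * \<bar>\<gamma>\<bar> * \<bar>\<alpha> - \<beta>\<bar>" using a by (simp add: abs_mult abs_minus_commute)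
    then have "\<bar>X \<alpha> t - X \<beta> t\<bar> + \<bar>W \<alpha> t - W \<beta> t\<bar> + \<bar>E \<alpha> t - E \<beta> t\<bar>
      \<le> 3 * exp (L * t) * ((1 + a * \<bar>\<gamma>\<bar>) * \<bar>\<alpha> - \<beta>\<bar>)"
      using L[rule_format, OF flow[of \<alpha>] flow[of \<beta>] t(1)] by (simp add: init distrib_right)
    also have "\<dots> \<le> 3 * exp (\<bar>L\<bar> * T) * ((1 + a * \<bar>\<gamma>\<bar>) * \<bar>\<alpha> - \<beta>\<bar>)"
    proof -
      have "L * t \<le> \<bar>L\<bar> * T" using t by (intro mult_mono) auto
      then show ?thesis using a by (intro mult_right_mono) auto
    qed
    finally show ?thesis by (simp add: C_def mult.assoc)
  qed
  show thesis
  proof (rule that[of C])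
    fix \<alpha> \<beta> t assume "0 \<le> t" "t \<le> T"
    from sum[OF this, of \<alpha> \<beta>]
    show "\<bar>X \<alpha> t - X \<beta> t\<bar> \<le> C * \<bar>\<alpha> - \<beta>\<bar>" "\<bar>W \<alpha> t - W \<beta> t\<bar> \<le> C * \<bar>\<alpha> - \<beta>\<bar>"
      "\<bar>E \<alpha> t - E \<beta> t\<bar> \<le> C * \<bar>\<alpha> - \<beta>\<bar>" by linarith+
  next
    show "C \<ge> 0" using a by (simp add: C_def)
  qed
qed

lemma continuous_param:
  assumes "t \<ge> 0"
  shows "continuous_on UNIV (\<lambda>\<alpha>. y \<alpha> t)" "continuous_on UNIV (\<lambda>\<alpha>. E \<alpha> t)"
proof -
  obtain C where C: "\<And>\<alpha> \<beta>. \<bar>X \<alpha> t - X \<beta> t\<bar> \<le> C * \<bar>\<alpha> - \<beta>\<bar>"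
    "\<And>\<alpha> \<beta>. \<bar>W \<alpha> t - W \<beta> t\<bar> \<le> C * \<bar>\<alpha> - \<beta>\<bar>"
    "\<And>\<alpha> \<beta>. \<bar>E \<alpha> t - E \<beta> t\<bar> \<le> C * \<bar>\<alpha> - \<beta>\<bar>" "C \<ge> 0"
    using dependence[of t] assms by (metis order_refl)
  show "continuous_on UNIV (\<lambda>\<alpha>. E \<alpha> t)"
    using C(3,4) by (rule abs_le_imp_continuous)
  have "continuous_on UNIV (\<lambda>\<alpha>. X \<alpha> t)" "continuous_on UNIV (\<lambda>\<alpha>. W \<alpha> t)"
    by (rule abs_le_imp_continuous[OF C(1,4)], rule abs_le_imp_continuous[OF C(2,4)])
  then show "continuous_on UNIV (\<lambda>\<alpha>. y \<alpha> t)"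
    unfolding y_def by (intro continuous_intros)
qed

lemma open_A: "open A"
proof -
  have "A = (\<Union>t\<in>{0..}. {\<alpha>. y \<alpha> t < 0} \<inter> {\<alpha>. E \<alpha> t < 0})"
    by (auto simp: A_def)
  moreover have "open {\<alpha>. y \<alpha> t < 0}" "open {\<alpha>. E \<alpha> t < 0}" if "t \<in> {0..}" for t
    using that continuous_param by (auto intro!: open_Collect_less continuous_on_const)
  ultimately show ?thesis by (simp only:) (intro open_UN ballI open_Int)
qed

text \<open>\<open>A\<close> is a union of open sets over single times, but \<open>B\<close>
  requires y > 0 on a whole interval. By compactness y has a positive minimum there, and the
  Lipschitz bound in \<alpha> is uniform over the interval.\<close>

lemma open_B: "open B"
proof (subst open_dist, intro ballI)
  fix \<alpha> assume "\<alpha> \<in> B"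
  then obtain t where t: "t \<ge> 0" "E \<alpha> t > 0" "\<And>r. 0 \<le> r \<Longrightarrow> r \<le> t \<Longrightarrow> 0 < y \<alpha> r"
    by (auto simp: B_def)
  obtain C where C: "\<And>\<alpha> \<beta> r. 0 \<le> r \<Longrightarrow> r \<le> t \<Longrightarrow> \<bar>X \<alpha> r - X \<beta> r\<bar> \<le> C * \<bar>\<alpha> - \<beta>\<bar>"
    "\<And>\<alpha> \<beta> r. 0 \<le> r \<Longrightarrow> r \<le> t \<Longrightarrow> \<bar>W \<alpha> r - W \<beta> r\<bar> \<le> C * \<bar>\<alpha> - \<beta>\<bar>"
    "\<And>\<alpha> \<beta> r. 0 \<le> r \<Longrightarrow> r \<le> t \<Longrightarrow> \<bar>E \<alpha> r - E \<beta> r\<bar> \<le> C * \<bar>\<alpha> - \<beta>\<bar>" "C \<ge> 0"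
    using dependence[of t] by metis
  have contX: "continuous_on {0..t} (X \<alpha>)" and conty: "continuous_on {0..t} (y \<alpha>)"
    using continuous_on_subset[OF halfline_continuous_on[OF X']]
      continuous_on_subset[OF halfline_continuous_on[OF y']] by auto
  obtain r0 where r0: "r0 \<in> {0..t}" "\<And>r. r \<in> {0..t} \<Longrightarrow> y \<alpha> r0 \<le> y \<alpha> r"
    using continuous_attains_inf[OF compact_Icc _ conty] t(1) by auto
  define \<mu> where "\<mu> = min (y \<alpha> r0) (E \<alpha> t)"
  have \<mu>: "\<mu> > 0" using t r0 by (auto simp: \<mu>_def)
  obtain K where "\<forall>r\<in>{0..t}. \<bar>X \<alpha> r\<bar> \<le> K"
    using compact_imp_bounded[OF compact_continuous_image[OF contX compact_Icc]]
    by (auto simp: bounded_iff)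
  then have K: "\<And>r. r \<in> {0..t} \<Longrightarrow> \<bar>X \<alpha> r\<bar> \<le> K" by blast
  have K0: "K \<ge> 0" using K[of 0] t(1) by simp
  \<comment> \<open>A Lipschitz constant of y in \<alpha>: \<open>C\<close> comes from W, the
    product from the square of X, where |X| <= K + C for parameters at distance at most 1. The
    summand 1 makes \<open>D\<close> positive.\<close>
  define D where "D = C + a * (K + C) * C + 1"
  have D: "D > 0" "C \<le> D" using C(4) a K0 by (auto simp: D_def add_nonneg_pos)
  show "\<exists>e>0. \<forall>\<beta>. dist \<beta> \<alpha> < e \<longrightarrow> \<beta> \<in> B"
  proof (intro exI[of _ "min 1 (\<mu> / D)"] conjI allI impI)
    fix \<beta> assume "dist \<beta> \<alpha> < min 1 (\<mu> / D)"
    then have d: "\<bar>\<alpha> - \<beta>\<bar> \<le> 1" "D * \<bar>\<alpha> - \<beta>\<bar> < \<mu>"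
      using D by (auto simp: dist_real_def abs_minus_commute pos_less_divide_eq mult.commute)
    have "C * \<bar>\<alpha> - \<beta>\<bar> \<le> D * \<bar>\<alpha> - \<beta>\<bar>" using D by (intro mult_right_mono) auto
    then have "E \<beta> t > 0" using C(3)[of t \<alpha> \<beta>] t(1) d by (auto simp: \<mu>_def)
    moreover have "0 < y \<beta> r" if r: "0 \<le> r" "r \<le> t" for r
    proof -
      have x: "\<bar>X \<alpha> r - X \<beta> r\<bar> \<le> C * \<bar>\<alpha> - \<beta>\<bar>" using C r by blast
      also have "\<dots> \<le> C * 1" using d C(4) by (intro mult_left_mono) auto
      finally have "\<bar>X \<beta> r\<bar> \<le> K + C" "\<bar>X \<alpha> r\<bar> \<le> K + C" using K[of r] r C(4) by auto
      then have "\<bar>(X \<alpha> r)\<^sup>2 - (X \<beta> r)\<^sup>2\<bar> \<le> 2 * (K + C) * \<bar>X \<alpha> r - X \<beta> r\<bar>"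
        by (intro abs_square_diff_le)
      also have "\<dots> \<le> 2 * (K + C) * (C * \<bar>\<alpha> - \<beta>\<bar>)"
        using x K0 C(4) by (intro mult_left_mono) auto
      finally have "a / 2 * \<bar>(X \<alpha> r)\<^sup>2 - (X \<beta> r)\<^sup>2\<bar> \<le> a / 2 * (2 * (K + C) * (C * \<bar>\<alpha> - \<beta>\<bar>))"
        using a by (intro mult_left_mono) auto
      then have "\<bar>a / 2 * (X \<alpha> r)\<^sup>2 - a / 2 * (X \<beta> r)\<^sup>2\<bar> \<le> a * (K + C) * C * \<bar>\<alpha> - \<beta>\<bar>"
        unfolding right_diff_distrib[symmetric] abs_mult using a by (simp add: mult.assoc distrib_right)
      moreover have "\<bar>W \<alpha> r - W \<beta> r\<bar> \<le> C * \<bar>\<alpha> - \<beta>\<bar>" using C r by blast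
      moreover have "D * \<bar>\<alpha> - \<beta>\<bar> = C * \<bar>\<alpha> - \<beta>\<bar> + a * (K + C) * C * \<bar>\<alpha> - \<beta>\<bar> + \<bar>\<alpha> - \<beta>\<bar>"
        by (simp add: D_def distrib_right)
      ultimately have "\<bar>y \<alpha> r - y \<beta> r\<bar> \<le> D * \<bar>\<alpha> - \<beta>\<bar>"
        unfolding y_def by linarith
      then show ?thesis using d(2) r0(2)[of r] r by (auto simp: \<mu>_def)
    qed
    ultimately show "\<beta> \<in> B" using t(1) by (auto simp: B_def)
  qed (use \<mu> D in auto)
qed

text \<open>Consider the last time \<sigma> up to which max(-y, E) <= 0; there z < 0 still holds. If
  y = 0, then E = z < 0, so y turns negative while E < 0, which is \<open>A\<close>. If E = 0 < y,
  then E' = b y^2 > 0 makes E positive; y was positive before, since it decreases up to \<sigma>,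
  and stays so by continuity, which is \<open>B\<close>. If both inequalities are strict, \<sigma>
  is not the last time.\<close>

lemma phase_forever:
  assumes "\<alpha> \<notin> A" "\<alpha> \<notin> B" and \<alpha>: "\<alpha> + a / 2 * \<gamma>\<^sup>2 \<le> Y" and low: "\<alpha> < 0 \<Longrightarrow> E \<alpha> 0 < 0"
  shows "phase \<alpha> T"
proof -
  have nA: False if "0 \<le> t" "y \<alpha> t < 0" "E \<alpha> t < 0" for t
    using that assms(1) by (auto simp: A_def)
  have nB: False if "0 \<le> t" "E \<alpha> t > 0" "\<And>r. 0 \<le> r \<Longrightarrow> r \<le> t \<Longrightarrow> 0 < y \<alpha> r" for t
    using that assms(2) by (auto simp: B_def)
  have \<alpha>0: "0 \<le> \<alpha>"
    using nA[of 0] low unfolding y0 by (metis order_refl linorder_not_le)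
  have E0: "E \<alpha> 0 \<le> 0"
  proof (rule ccontr)
    assume *: "\<not> E \<alpha> 0 \<le> 0"
    \<comment> \<open>E(0) = -1 at \<alpha> = 0. Hence E(0) > 0 leaves only \<alpha> > 0, and time 0
      witnesses \<open>B\<close>.\<close>
    then have "\<alpha> \<noteq> 0" by (auto simp: init)
    then show False using nB[of 0] * \<alpha>0 by (auto simp: y0)
  qed
  define g where "g t = max (- y \<alpha> t) (E \<alpha> t)" for t
  have cy: "continuous_on {0..} (y \<alpha>)" and cE: "continuous_on {0..} (E \<alpha>)"
    by (rule halfline_continuous_on[OF y'] halfline_continuous_on[OF E'], assumption)+
  then have cg: "continuous_on {0..} g" unfolding g_def by (intro continuous_intros)
  have "g t \<le> 0" if "0 \<le> t" for t
  proof (rule ccontr)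
    assume t: "\<not> g t \<le> 0"
    have "continuous_on {0..t} g" using cg by (rule continuous_on_subset) auto
    moreover have "g 0 \<le> 0" using \<alpha>0 E0 by (simp add: g_def y0)
    moreover have "g t > 0" using t by simp
    moreover note \<open>0 \<le> t\<close>
    ultimately obtain \<sigma> where \<sigma>: "0 \<le> \<sigma>" "\<And>r. 0 \<le> r \<Longrightarrow> r \<le> \<sigma> \<Longrightarrow> g r \<le> 0"
      and after: "\<And>e. e > 0 \<Longrightarrow> \<exists>r. \<sigma> < r \<and> r < \<sigma> + e \<and> g r > 0"
      using last_nonpos[of 0 t g] by blast
    have ph: "phase \<alpha> \<sigma>" using \<sigma> by (auto simp: phase_def g_def)
    have P: "s \<alpha> \<sigma> = y \<alpha> \<sigma>" "clip 0 Y (s \<alpha> \<sigma>) = y \<alpha> \<sigma>"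
      using phase_bounds[OF ph \<alpha> \<sigma>(1)] by auto
    have zneg: "z \<alpha> r < 0" if "0 \<le> r" "r \<le> \<sigma>" for r
      using phase_z_neg[OF ph \<alpha>] that by auto
    have near: "\<exists>d>0. \<forall>r. \<sigma> \<le> r \<longrightarrow> r < \<sigma> + d \<longrightarrow> h r < 0"
      if h: "continuous_on {0..} h" "h \<sigma> < 0" for h :: "real \<Rightarrow> real"
    proof -
      have "0 < - h \<sigma>" "\<sigma> \<in> {0..}" using h \<sigma>(1) by auto
      then obtain d where d: "d > 0"
        "\<And>r. r \<in> {0..} \<Longrightarrow> dist r \<sigma> < d \<Longrightarrow> dist (h r) (h \<sigma>) < - h \<sigma>"
        using h(1) unfolding continuous_on_iff by blast
      have "h r < 0" if "\<sigma> \<le> r" "r < \<sigma> + d" for r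
      proof -
        have "dist (h r) (h \<sigma>) < - h \<sigma>"
          by (rule d(2)) (use that \<sigma>(1) in \<open>auto simp: dist_real_def\<close>)
        then show ?thesis by (simp add: dist_real_def)
      qed
      with d(1) show ?thesis by blast
    qed
    consider "y \<alpha> \<sigma> = 0" | "y \<alpha> \<sigma> > 0" "E \<alpha> \<sigma> < 0" | "y \<alpha> \<sigma> > 0" "E \<alpha> \<sigma> = 0"
    proof -
      have "0 \<le> y \<alpha> \<sigma>" "E \<alpha> \<sigma> \<le> 0" using \<sigma>(2)[of \<sigma>] \<sigma>(1) by (simp_all add: g_def)
      then show thesis using that by (metis order_le_less)
    qed
    then show False
    proof cases
      case 1
      then have E: "E \<alpha> \<sigma> < 0" using zneg[of \<sigma>] \<sigma>(1) by (simp add: z_def)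
      have "(y \<alpha> has_real_derivative E \<alpha> \<sigma>) (at \<sigma> within {0..})"
        using y'[OF \<sigma>(1), of \<alpha>] P 1 by simp
      from has_real_derivative_neg_dec_right[OF this E] obtain d1
        where d1: "d1 > 0" "\<And>h. h > 0 \<Longrightarrow> \<sigma> + h \<in> {0..} \<Longrightarrow> h < d1 \<Longrightarrow> y \<alpha> (\<sigma> + h) < y \<alpha> \<sigma>"
        by auto
      obtain d2 where d2: "d2 > 0" "\<And>r. \<sigma> \<le> r \<Longrightarrow> r < \<sigma> + d2 \<Longrightarrow> E \<alpha> r < 0"
        using near[OF cE E] by auto
      show False
        using d1(1) d1(2)[of "min d1 d2 / 2"] d2(1) d2(2)[of "\<sigma> + min d1 d2 / 2"] \<sigma>(1) 1
          nA[of "\<sigma> + min d1 d2 / 2"] by auto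
    next
      case 2
      then have "g \<sigma> < 0" by (simp add: g_def)
      then obtain d where "d > 0" and d: "\<And>r. \<sigma> \<le> r \<Longrightarrow> r < \<sigma> + d \<Longrightarrow> g r < 0"
        using near[OF cg] by blast
      then obtain r where "\<sigma> < r" "r < \<sigma> + d" "g r > 0" using after by blast
      with d[of r] show False by simp
    next
      case 3
      have pos: "0 < y \<alpha> r" if r: "0 \<le> r" "r \<le> \<sigma>" for r
      proof (cases "r = \<sigma>")
        case False
        have "y \<alpha> \<sigma> < y \<alpha> r"
        proof (rule halfline_less[OF y'])
          fix q assume "r < q" "q < \<sigma>"
          then show "E \<alpha> q - a * X \<alpha> q * s \<alpha> q < 0"
            using zneg[of q] phase_bounds(2)[OF ph \<alpha>, of q] r by (simp add: z_def)
        qed (use False r in auto)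
        then show ?thesis using 3 by simp
      qed (use 3 in auto)
      have "0 < b * (clip 0 Y (s \<alpha> \<sigma>))\<^sup>2" using P 3 b by simp
      from has_real_derivative_pos_inc_right[OF E'[OF \<sigma>(1)] this] obtain d1
        where d1: "d1 > 0" "\<And>h. h > 0 \<Longrightarrow> \<sigma> + h \<in> {0..} \<Longrightarrow> h < d1 \<Longrightarrow> E \<alpha> (\<sigma> + h) > E \<alpha> \<sigma>"
        by auto
      obtain d2 where d2: "d2 > 0" "\<And>r. \<sigma> \<le> r \<Longrightarrow> r < \<sigma> + d2 \<Longrightarrow> - y \<alpha> r < 0"
        using near[of "\<lambda>r. - y \<alpha> r"] cy 3 by (auto intro: continuous_on_minus)
      define u where "u = \<sigma> + min d1 d2 / 2"
      have u: "\<sigma> < u" "u < \<sigma> + d1" "u < \<sigma> + d2" using d1(1) d2(1) by (auto simp: u_def)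
      have "E \<alpha> u > 0" using d1(2)[of "u - \<sigma>"] u \<sigma>(1) 3 by simp
      moreover have "0 < y \<alpha> r" if "0 \<le> r" "r \<le> u" for r
        using pos[of r] d2(2)[of r] that u by (cases "r \<le> \<sigma>") auto
      ultimately show False using nB[of u] u \<sigma>(1) by auto
    qed
  qed
  then show ?thesis by (auto simp: phase_def g_def)
qed

text \<open>The condition \<open>low\<close> keeps the left end close to 0: for \<gamma> > 0 and
  \<alpha> very negative, E(0) = -1 - a \<gamma> \<alpha> is positive, and time 0 would then witness
  neither event.\<close>

lemma shoot:
  assumes "\<alpha>0 \<in> A" "\<alpha>1 \<in> B" "\<alpha>0 \<le> \<alpha>1" "\<alpha>1 + a / 2 * \<gamma>\<^sup>2 \<le> Y"
    and low: "\<And>\<alpha>. \<alpha>0 \<le> \<alpha> \<Longrightarrow> \<alpha> < 0 \<Longrightarrow> E \<alpha> 0 < 0"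
  shows "\<exists>\<alpha>. \<alpha> + a / 2 * \<gamma>\<^sup>2 \<le> Y \<and> (\<forall>T. phase \<alpha> T)"
proof -
  have "\<not> {\<alpha>0..\<alpha>1} \<subseteq> A \<union> B"
  proof
    assume "{\<alpha>0..\<alpha>1} \<subseteq> A \<union> B"
    then have "A \<inter> {\<alpha>0..\<alpha>1} = {} \<or> B \<inter> {\<alpha>0..\<alpha>1} = {}"
      using A_Int_B by (intro connectedD[OF connected_Icc open_A open_B]) auto
    then show False using assms by auto
  qed
  then obtain \<alpha> where "\<alpha>0 \<le> \<alpha>" "\<alpha> \<le> \<alpha>1" "\<alpha> \<notin> A" "\<alpha> \<notin> B"
    by (meson UnI1 UnI2 atLeastAtMost_iff subsetI)
  then show ?thesis using assms(4) low phase_forever[of \<alpha>] by (intro exI[of _ \<alpha>]) auto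
qed

end

section \<open>Large and small initial slopes, and the resulting global solution\<close>

text \<open>The inequalities under which \<open>q\<^sup>2\<close> belongs to \<open>B\<close>, with
  G bounding |\<gamma>|. The time 1 / (20 q) is such that X, moving at speed at most 5 q^2, travels
  at most q / 4. In the last inequality the gain of E has order q^3 and beats the initial deficit of
  order q^2.\<close>

lemma large_parameter:
  fixes b G :: real
  assumes "b > 0" "G > 0"
  shows "\<exists>q>0. q\<^sup>2 + G\<^sup>2 + (1 + 2 * G * q\<^sup>2) * (1 / (20 * q)) + 2 * (q\<^sup>2 + G\<^sup>2)\<^sup>2 * (1 / (20 * q))\<^sup>2 \<le> 3 * q\<^sup>2
    \<and> G\<^sup>2 + 1 \<le> q\<^sup>2
    \<and> 3 / 4 * (G + q / 4)\<^sup>2 \<le> q\<^sup>2 / 4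
    \<and> (1 + 2 * G * q\<^sup>2) * (1 / (20 * q)) \<le> q\<^sup>2 / 4
    \<and> 0 < - (1 + 2 * G * q\<^sup>2) + b * (q\<^sup>2 / 2)\<^sup>2 * (1 / (20 * q))"
proof -
  have "\<forall>\<^sub>F q::real in at_top. q > 0"
    by (rule eventually_gt_at_top)
  moreover have "\<forall>\<^sub>F q in at_top. q\<^sup>2 + G\<^sup>2 + (1 + 2 * G * q\<^sup>2) * (1 / (20 * q)) + 2 * (q\<^sup>2 + G\<^sup>2)\<^sup>2 * (1 / (20 * q))\<^sup>2 \<le> 3 * q\<^sup>2"
  proof -
    have "\<forall>\<^sub>F q in at_top. q\<^sup>2 + G\<^sup>2 + (1 + 2 * G * q\<^sup>2) * (1 / (20 * q)) + 2 * (q\<^sup>2 + G\<^sup>2)\<^sup>2 * (1 / (400 * q\<^sup>2)) \<le> 3 * q\<^sup>2"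
      using assms by real_asymp
    then show ?thesis by (simp add: power_divide power_mult_distrib)
  qed
  moreover have "\<forall>\<^sub>F q in at_top. G\<^sup>2 + 1 \<le> q\<^sup>2"
    using assms by real_asymp
  moreover have "\<forall>\<^sub>F q in at_top. 3 / 4 * (G + q / 4)\<^sup>2 \<le> q\<^sup>2 / 4"
  proof -
    have "\<forall>\<^sub>F q in at_top. 3 * (4 * G + q)\<^sup>2 \<le> 16 * q\<^sup>2"
      using assms by real_asymp
    moreover have "(4 * G + q)\<^sup>2 = 16 * (G + q / 4)\<^sup>2" for q
      by (simp add: power2_eq_square algebra_simps)
    ultimately show ?thesis by simp
  qed
  moreover have "\<forall>\<^sub>F q in at_top. (1 + 2 * G * q\<^sup>2) * (1 / (20 * q)) \<le> q\<^sup>2 / 4"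
    using assms by real_asymp
  moreover have "\<forall>\<^sub>F q in at_top. 0 < - (1 + 2 * G * q\<^sup>2) + b * (q\<^sup>2 / 2)\<^sup>2 * (1 / (20 * q))"
    using assms by real_asymp
  ultimately have "\<forall>\<^sub>F q in at_top. q > 0 \<and> q\<^sup>2 + G\<^sup>2 + (1 + 2 * G * q\<^sup>2) * (1 / (20 * q)) + 2 * (q\<^sup>2 + G\<^sup>2)\<^sup>2 * (1 / (20 * q))\<^sup>2 \<le> 3 * q\<^sup>2
    \<and> G\<^sup>2 + 1 \<le> q\<^sup>2
    \<and> 3 / 4 * (G + q / 4)\<^sup>2 \<le> q\<^sup>2 / 4
    \<and> (1 + 2 * G * q\<^sup>2) * (1 / (20 * q)) \<le> q\<^sup>2 / 4
    \<and> 0 < - (1 + 2 * G * q\<^sup>2) + b * (q\<^sup>2 / 2)\<^sup>2 * (1 / (20 * q))"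
    by eventually_elim blast
  then show ?thesis by (rule eventually_happens'[OF trivial_limit_at_top_linorder])
qed

context shooting begin

text \<open>The region is of no help here, as E may change sign; crude bounds on [0, t0] replace it.
  The bounds -e <= E <= e + b Y^2 t0 keep W between Y - \<alpha>/4 and 3 \<alpha>, hence |s| <= 5
  \<alpha>, hence a/2 X^2 <= \<alpha>/4 and y >= \<alpha>/2. Then E grows at rate at least b
  (\<alpha>/2)^2, enough to become positive by time t0.\<close>

lemma large_in_B:
  fixes q G :: real
  defines "t0 \<equiv> 1 / (20 * q)"
  assumes a2: "a \<le> 3 / 2" and YE: "Y = q\<^sup>2 + a / 2 * \<gamma>\<^sup>2" and q: "q > 0"
    and G: "\<bar>\<gamma>\<bar> \<le> G"
    and 1: "q\<^sup>2 + G\<^sup>2 + (1 + 2 * G * q\<^sup>2) * t0 + 2 * (q\<^sup>2 + G\<^sup>2)\<^sup>2 * t0\<^sup>2 \<le> 3 * q\<^sup>2"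
    and 2: "G\<^sup>2 + 1 \<le> q\<^sup>2" and 3: "3 / 4 * (G + q / 4)\<^sup>2 \<le> q\<^sup>2 / 4"
    and 4: "(1 + 2 * G * q\<^sup>2) * t0 \<le> q\<^sup>2 / 4"
    and 5: "0 < - (1 + 2 * G * q\<^sup>2) + b * (q\<^sup>2 / 2)\<^sup>2 * t0"
  shows "q\<^sup>2 \<in> B"
proof -
  define \<alpha> where "\<alpha> = q\<^sup>2"
  define e where "e = 1 + 2 * G * \<alpha>"
  have t0: "t0 > 0" using q by (simp add: t0_def)
  have \<alpha>: "\<alpha> > 0" using q by (simp add: \<alpha>_def)
  have \<alpha>1: "1 \<le> \<alpha>" using 2 zero_le_power2[of G] unfolding \<alpha>_def by linarith
  have e: "e > 0" using \<alpha> G by (simp add: e_def add_pos_nonneg)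
  have "a / 2 * \<gamma>\<^sup>2 \<le> 1 * \<gamma>\<^sup>2" using a2 by (intro mult_right_mono) auto
  moreover have "\<gamma>\<^sup>2 \<le> G\<^sup>2" using power_mono[OF G, of 2] by simp
  ultimately have Y1: "Y \<le> q\<^sup>2 + G\<^sup>2" by (simp add: YE)
  have Y2: "\<alpha> \<le> Y" using a by (simp add: YE \<alpha>_def)
  have "\<bar>a * \<gamma> * \<alpha>\<bar> \<le> 2 * G * \<alpha>"
    unfolding abs_mult using a a2 \<alpha> G by (intro mult_mono) auto
  then have E0: "\<bar>E \<alpha> 0\<bar> \<le> e" by (simp add: init e_def)
  have "Y\<^sup>2 \<le> (q\<^sup>2 + G\<^sup>2)\<^sup>2" using Y Y1 by (intro power_mono) auto
  then have bY: "b * Y\<^sup>2 \<le> 2 * (q\<^sup>2 + G\<^sup>2)\<^sup>2" using b a2 by (intro mult_mono) auto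
  have Ege: "- e \<le> E \<alpha> t" if "0 \<le> t" for t
    using E_mono[of 0 t \<alpha>] that E0 by auto
  have Ele: "E \<alpha> t \<le> e + b * Y\<^sup>2 * t0" if t: "0 \<le> t" "t \<le> t0" for t
  proof -
    have "E \<alpha> t \<le> E \<alpha> 0 + (b * Y\<^sup>2) * (t - 0)"
    proof (rule halfline_le[OF E'])
      show "b * (clip 0 Y (s \<alpha> r))\<^sup>2 \<le> b * Y\<^sup>2" for r
        using Y b by (intro mult_left_mono power_mono) (auto simp: clip_def)
    qed (use t in auto)
    also have "\<dots> \<le> e + (b * Y\<^sup>2) * t0"
      using E0 t b by (intro add_mono mult_left_mono) auto
    finally show ?thesis .
  qed
  have Wge: "Y - e * t0 \<le> W \<alpha> t" if t: "0 \<le> t" "t \<le> t0" for t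
  proof -
    have "W \<alpha> 0 + (- e) * (t - 0) \<le> W \<alpha> t"
      using t Ege by (intro halfline_ge[OF W']) auto
    moreover have "e * t \<le> e * t0" using t e by simp
    ultimately show ?thesis by (simp add: init YE \<alpha>_def)
  qed
  have Wle: "W \<alpha> t \<le> 3 * \<alpha>" if t: "0 \<le> t" "t \<le> t0" for t
  proof -
    have "W \<alpha> t \<le> W \<alpha> 0 + (e + b * Y\<^sup>2 * t0) * (t - 0)"
      using t Ele by (intro halfline_le[OF W']) auto
    also have "\<dots> \<le> Y + (e + b * Y\<^sup>2 * t0) * t0"
      using t t0 e b by (simp add: init YE \<alpha>_def mult_left_mono)
    also have "\<dots> = Y + e * t0 + b * Y\<^sup>2 * t0\<^sup>2" by (simp add: distrib_right power2_eq_square)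
    also have "\<dots> \<le> q\<^sup>2 + G\<^sup>2 + e * t0 + 2 * (q\<^sup>2 + G\<^sup>2)\<^sup>2 * t0\<^sup>2"
      using Y1 bY t0 by (intro add_mono mult_right_mono) auto
    finally show ?thesis using 1 by (simp add: e_def \<alpha>_def)
  qed
  have et0: "e * t0 \<le> \<alpha> / 4" using 4 by (simp add: e_def \<alpha>_def)
  \<comment> \<open>This avoids a circle: s is bounded below by W - (Y + 1) before anything is known
    about X, and the bound on X is then derived from the bound on s.\<close>
  have clipM: "a / 2 * (clip (- M) M u)\<^sup>2 \<le> Y + 1" for u
  proof -
    have "(clip (- M) M u)\<^sup>2 \<le> M\<^sup>2" using clip_abs_le[OF M, of u] M by (simp add: power2_le_iff_abs_le)
    then have "a / 2 * (clip (- M) M u)\<^sup>2 \<le> a / 2 * M\<^sup>2" using a by (intro mult_left_mono) auto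
    then show ?thesis using MY by linarith
  qed
  have yge: "\<alpha> / 2 \<le> y \<alpha> t" if t: "0 \<le> t" "t \<le> t0" for t
  proof -
    have s1: "s \<alpha> r \<le> 5 * \<alpha>" and s2: "- (5 * \<alpha>) \<le> s \<alpha> r" if "0 < r" "r < t" for r
    proof -
      have r: "0 \<le> r" "r \<le> t0" using that t by auto
      have "0 \<le> a / 2 * (clip (- M) M (X \<alpha> r))\<^sup>2" using a by simp
      then show "s \<alpha> r \<le> 5 * \<alpha>" "- (5 * \<alpha>) \<le> s \<alpha> r"
        using clipM[of "X \<alpha> r"] Wle[OF r] Wge[OF r] et0 \<alpha>1 unfolding s_def slope_def by linarith+
    qed
    have "X \<alpha> t \<le> X \<alpha> 0 + 5 * \<alpha> * (t - 0)" using t s1 by (intro halfline_le[OF X']) auto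
    moreover have "X \<alpha> 0 + (- (5 * \<alpha>)) * (t - 0) \<le> X \<alpha> t" using t s2 by (intro halfline_ge[OF X']) auto
    moreover have "5 * \<alpha> * t \<le> 5 * \<alpha> * t0" using t \<alpha> by simp
    moreover have "5 * \<alpha> * t0 = q / 4" using q by (simp add: \<alpha>_def t0_def power2_eq_square)
    ultimately have "\<bar>X \<alpha> t\<bar> \<le> G + q / 4" using G by (simp add: init)
    then have "(X \<alpha> t)\<^sup>2 \<le> (G + q / 4)\<^sup>2"
      using power_mono[of "\<bar>X \<alpha> t\<bar>" "G + q / 4" 2] by simp
    then have "a / 2 * (X \<alpha> t)\<^sup>2 \<le> 3 / 4 * (G + q / 4)\<^sup>2"
      using a a2 by (intro mult_mono) auto
    then show ?thesis using 3 Wge[OF t] et0 Y2 by (simp add: y_def \<alpha>_def)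
  qed
  have "E \<alpha> 0 + (b * (\<alpha> / 2)\<^sup>2) * (t0 - 0) \<le> E \<alpha> t0"
  proof (rule halfline_ge[OF E'])
    fix r assume r: "0 < r" "r < t0"
    \<comment> \<open>Clipping can only shrink the subtracted square, so s >= y holds whether or not
      |X| exceeds M.\<close>
    have "(clip (- M) M (X \<alpha> r))\<^sup>2 \<le> (X \<alpha> r)\<^sup>2"
      using clip_abs_le_abs[OF M, of "X \<alpha> r"] by (simp add: abs_le_square_iff)
    then have "y \<alpha> r \<le> s \<alpha> r"
      using a by (simp add: y_def s_def slope_def)
    then have "\<alpha> / 2 \<le> clip 0 Y (s \<alpha> r)"
      using yge[of r] r Y2 \<alpha> by (auto simp: clip_def)
    then show "b * (\<alpha> / 2)\<^sup>2 \<le> b * (clip 0 Y (s \<alpha> r))\<^sup>2"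
      using b \<alpha> by (intro mult_left_mono power_mono) auto
  qed (use t0 in auto)
  then have "E \<alpha> t0 > 0" using 5 E0 by (simp add: e_def \<alpha>_def)
  moreover have "0 < y \<alpha> r" if "0 \<le> r" "r \<le> t0" for r
    using yge[OF that] \<alpha> by simp
  ultimately show ?thesis using t0 unfolding \<alpha>_def B_def by (auto intro!: exI[of _ t0])
qed

lemma small_in_A: 
  assumes "\<alpha> < 0" "a * \<bar>\<gamma>\<bar> * \<bar>\<alpha>\<bar> < 1"
  shows "\<alpha> \<in> A" "E \<alpha> 0 < 0"
proof -
  have "\<bar>a * \<gamma> * \<alpha>\<bar> < 1" using assms a by (simp add: abs_mult)
  then show "E \<alpha> 0 < 0" by (simp add: init)
  then show "\<alpha> \<in> A" using assms(1) by (auto simp: A_def y0 intro!: exI[of _ 0])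
qed

end

lemma global_phase:
  fixes a b \<gamma> :: real
  assumes a: "0 < a" "a \<le> 3 / 2" and b: "0 < b" "b \<le> a"
  shows "\<exists>\<alpha> x y z. x 0 = - \<gamma> \<and> y 0 = \<alpha> \<and> z 0 = - 1 \<and> (\<forall>t\<ge>0.
      (x has_real_derivative y t) (at t within {0..}) \<and>
      (y has_real_derivative z t) (at t within {0..}) \<and>
      (z has_real_derivative - a * x t * z t - (a - b) * (y t)\<^sup>2) (at t within {0..}) \<and>
      0 \<le> y t \<and> z t < 0 \<and> a / 2 * (x t)\<^sup>2 \<le> \<alpha> + a / 2 * \<gamma>\<^sup>2)"
proof -
  \<comment> \<open>\<open>large_parameter\<close> asks for a positive bound; the summand 1 provides
    it also for \<gamma> = 0.\<close>
  define G where "G = \<bar>\<gamma>\<bar> + 1"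
  have G: "\<bar>\<gamma>\<bar> \<le> G" "G > 0" by (simp_all add: G_def)
  obtain q where q: "q > 0"
    "q\<^sup>2 + G\<^sup>2 + (1 + 2 * G * q\<^sup>2) * (1 / (20 * q)) + 2 * (q\<^sup>2 + G\<^sup>2)\<^sup>2 * (1 / (20 * q))\<^sup>2 \<le> 3 * q\<^sup>2"
    "G\<^sup>2 + 1 \<le> q\<^sup>2" "3 / 4 * (G + q / 4)\<^sup>2 \<le> q\<^sup>2 / 4"
    "(1 + 2 * G * q\<^sup>2) * (1 / (20 * q)) \<le> q\<^sup>2 / 4"
    "0 < - (1 + 2 * G * q\<^sup>2) + b * (q\<^sup>2 / 2)\<^sup>2 * (1 / (20 * q))"
    using large_parameter[OF b(1) G(2)] by blast
  \<comment> \<open>The value of w(0) at the largest parameter \<open>q\<^sup>2\<close>, so every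
    smaller parameter starts with w(0) <= Y.\<close>
  define Y where "Y = q\<^sup>2 + a / 2 * \<gamma>\<^sup>2"
  define M where "M = sqrt (2 * (Y + 1) / a)"
  have Y: "0 \<le> Y" using a by (simp add: Y_def)
  then have M: "0 \<le> M" "a / 2 * M\<^sup>2 = Y + 1" using a by (simp_all add: M_def)
  have "\<exists>p. \<forall>\<alpha>. is_flow a b M Y (fst (p \<alpha>)) (fst (snd (p \<alpha>))) (snd (snd (p \<alpha>))) \<and>
      fst (p \<alpha>) 0 = - \<gamma> \<and> fst (snd (p \<alpha>)) 0 = \<alpha> + a / 2 * \<gamma>\<^sup>2 \<and> snd (snd (p \<alpha>)) 0 = - 1 - a * \<gamma> * \<alpha>"
    using flow_exists[of a b M Y] a b M Y by (intro choice allI) simp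
  then obtain p where p: "\<And>\<alpha>. is_flow a b M Y (fst (p \<alpha>)) (fst (snd (p \<alpha>))) (snd (snd (p \<alpha>)))"
      "\<And>\<alpha>. fst (p \<alpha>) 0 = - \<gamma>" "\<And>\<alpha>. fst (snd (p \<alpha>)) 0 = \<alpha> + a / 2 * \<gamma>\<^sup>2"
      "\<And>\<alpha>. snd (snd (p \<alpha>)) 0 = - 1 - a * \<gamma> * \<alpha>" by blast
  interpret S: shooting a b \<gamma> M Y "\<lambda>\<alpha>. fst (p \<alpha>)" "\<lambda>\<alpha>. fst (snd (p \<alpha>))" "\<lambda>\<alpha>. snd (snd (p \<alpha>))"
    using a b M Y p by unfold_locales auto
  \<comment> \<open>Chosen so that a |\<gamma>| |\<alpha>0| < 1, which gives E(0) < 0 at \<alpha>0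
    and at every \<alpha> between \<alpha>0 and 0.\<close>
  define \<alpha>0 where "\<alpha>0 = - 1 / (1 + a * \<bar>\<gamma>\<bar>)"
  have pos: "1 + a * \<bar>\<gamma>\<bar> > 0" using a by (simp add: add_pos_nonneg)
  have \<alpha>0: "\<alpha>0 < 0" using pos by (simp add: \<alpha>0_def)
  have "\<bar>\<alpha>0\<bar> = 1 / (1 + a * \<bar>\<gamma>\<bar>)" using pos by (simp add: \<alpha>0_def abs_divide)
  then have small: "a * \<bar>\<gamma>\<bar> * \<bar>\<alpha>0\<bar> < 1" using pos by simp
  have low: "snd (snd (p \<alpha>)) 0 < 0" if "\<alpha>0 \<le> \<alpha>" "\<alpha> < 0" for \<alpha>
  proof (rule S.small_in_A(2)[OF that(2)])
    have "a * \<bar>\<gamma>\<bar> * \<bar>\<alpha>\<bar> \<le> a * \<bar>\<gamma>\<bar> * \<bar>\<alpha>0\<bar>" using that a by (intro mult_left_mono) auto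
    then show "a * \<bar>\<gamma>\<bar> * \<bar>\<alpha>\<bar> < 1" using small by simp
  qed
  have B: "q\<^sup>2 \<in> S.B"
    using a(2) Y_def q(1) G(1) q(2-) by (rule S.large_in_B)
  have "\<alpha>0 \<le> q\<^sup>2" using \<alpha>0 by (smt (verit) zero_le_power2)
  from S.shoot[OF S.small_in_A(1)[OF \<alpha>0 small] B this _ low] obtain \<alpha>
    where \<alpha>: "\<alpha> + a / 2 * \<gamma>\<^sup>2 \<le> Y" "\<And>T. S.phase \<alpha> T" by (auto simp: Y_def)
  have P: "S.s \<alpha> t = S.y \<alpha> t" "clip 0 Y (S.s \<alpha> t) = S.y \<alpha> t" "S.z \<alpha> t < 0"
    "a / 2 * (fst (p \<alpha>) t)\<^sup>2 \<le> \<alpha> + a / 2 * \<gamma>\<^sup>2" "0 \<le> S.y \<alpha> t" if "t \<ge> 0" for t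
    using S.phase_bounds[OF \<alpha>(2) \<alpha>(1) that order_refl]
      S.phase_z_neg[OF \<alpha>(2) \<alpha>(1) that order_refl] \<alpha>(2)[of t] that
    by (auto simp: S.phase_def)
  have "(fst (p \<alpha>) has_real_derivative S.y \<alpha> t) (at t within {0..})"
    "(S.y \<alpha> has_real_derivative S.z \<alpha> t) (at t within {0..})" if "t \<ge> 0" for t
    using S.X'[OF that, of \<alpha>] S.y'[OF that, of \<alpha>] unfolding P(1)[OF that]
    by (simp_all add: S.z_def)
  moreover have "(S.z \<alpha> has_real_derivative
      - a * fst (p \<alpha>) t * S.z \<alpha> t - (a - b) * (S.y \<alpha> t)\<^sup>2) (at t within {0..})" if "t \<ge> 0" for t
    by (rule DERIV_cong[OF S.z'[OF that]], unfold P(2)[OF that], unfold P(1)[OF that])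
      (simp add: S.z_def power2_eq_square left_diff_distrib)
  ultimately show ?thesis
    using P p(2) by (intro exI[of _ \<alpha>] exI[of _ "fst (p \<alpha>)"] exI[of _ "S.y \<alpha>"] exI[of _ "S.z \<alpha>"])
      (auto simp: S.y0 S.z0)
qed

section \<open>Comparison of bounded solutions in the phase plane\<close>

text \<open>The independent variable is now a value of f instead of a time, so intervals need not
  lie in the half-line and derivatives are two-sided inside them.\<close>

lemma deriv_ge_imp_ge:
  fixes f f' :: "real \<Rightarrow> real"
  assumes "a \<le> b" "continuous_on {a..b} f"
    and f: "\<And>s. a < s \<Longrightarrow> s < b \<Longrightarrow> (f has_real_derivative f' s) (at s)"
    and c: "\<And>s. a < s \<Longrightarrow> s < b \<Longrightarrow> c \<le> f' s"
  shows "f a + c * (b - a) \<le> f b"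
proof (cases "a = b")
  case False
  then have "a < b" using assms by simp
  obtain \<xi> where \<xi>: "a < \<xi>" "\<xi> < b" "f b - f a = f' \<xi> * (b - a)"
    using mvt[OF \<open>a < b\<close> assms(2), of "\<lambda>s. (*) (f' s)"] f by (auto simp: has_field_derivative_def)
  then have "c * (b - a) \<le> f' \<xi> * (b - a)" using c[of \<xi>] assms(1) by (intro mult_right_mono) auto
  with \<xi> show ?thesis by linarith
qed simp

text \<open>\<open>V\<close> and \<open>G\<close> are \<open>f'\<close> and \<open>f'' + a f f'\<close> as functions of \<open>s = f(t)\<close>.\<close>

locale profile =
  fixes a b s0 L :: real and V G :: "real \<Rightarrow> real"
  assumes less: "s0 < L"
    and contV: "continuous_on {s0..<L} V" and contG: "continuous_on {s0..<L} G"
    and V': "\<And>s. s0 < s \<Longrightarrow> s < L \<Longrightarrow> (V has_real_derivative G s / V s - a * s) (at s)"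
    and G': "\<And>s. s0 < s \<Longrightarrow> s < L \<Longrightarrow> (G has_real_derivative b * V s) (at s)"
    and Vpos: "\<And>s. s0 \<le> s \<Longrightarrow> s < L \<Longrightarrow> 0 < V s"
    and Gneg: "\<And>s. s0 \<le> s \<Longrightarrow> s < L \<Longrightarrow> G s \<le> 0"
    and Vlim: "(V \<longlongrightarrow> 0) (at_left L)" and Glim: "(G \<longlongrightarrow> 0) (at_left L)"

text \<open>In D = V2 - V1 the terms - a s cancel, leaving D' = G2/V2 - G1/V1. While D > 0 and K =
  G2 - G1 >= 0, the sign G1 <= 0 gives G1/V1 <= G1/V2 <= G2/V2, so D does not decrease; and K' = b D
  keeps K nonnegative.\<close>

lemma profile_compare:
  assumes "profile a b s0 L1 V1 G1" "profile a b s0 L2 V2 G2" and b: "0 < b"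
    and D0: "V1 s0 < V2 s0" and K0: "G1 s0 \<le> G2 s0"
  shows False
proof -
  interpret P1: profile a b s0 L1 V1 G1 by fact
  interpret P2: profile a b s0 L2 V2 G2 by fact
  define D K where "D s = V2 s - V1 s" and "K s = G2 s - G1 s" for s
  define \<Lambda> where "\<Lambda> = min L1 L2"
  have \<Lambda>: "s0 < \<Lambda>" using P1.less P2.less by (simp add: \<Lambda>_def)
  have contD: "continuous_on {s0..s} D" and contK: "continuous_on {s0..s} K" if "s < \<Lambda>" for s
    unfolding D_def K_def using that
    by (auto simp: \<Lambda>_def intro!: continuous_on_diff continuous_on_subset[OF P1.contV]
        continuous_on_subset[OF P2.contV] continuous_on_subset[OF P1.contG] continuous_on_subset[OF P2.contG])
  have D': "(D has_real_derivative G2 s / V2 s - G1 s / V1 s) (at s)"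
    and K': "(K has_real_derivative b * D s) (at s)" if "s0 < s" "s < \<Lambda>" for s
  proof -
    show "(D has_real_derivative G2 s / V2 s - G1 s / V1 s) (at s)"
      unfolding D_def using that
      by (intro DERIV_cong[OF DERIV_diff[OF P2.V' P1.V']]) (auto simp: \<Lambda>_def)
    show "(K has_real_derivative b * D s) (at s)"
      unfolding K_def D_def using that
      by (intro DERIV_cong[OF DERIV_diff[OF P2.G' P1.G']]) (auto simp: \<Lambda>_def right_diff_distrib)
  qed
  have D0': "D s0 > 0" and K0': "K s0 \<ge> 0" using D0 K0 by (simp_all add: D_def K_def)
  \<comment> \<open>Positivity of D is assumed only before \<open>s\<close>. Applied at a first zero
    of D, this yields D >= D(s0) > 0 there, which removes the assumption.\<close>
  have growth: "D s0 \<le> D s" if s: "s0 \<le> s" "s < \<Lambda>" and pos: "\<And>r. s0 \<le> r \<Longrightarrow> r < s \<Longrightarrow> 0 < D r" for s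
  proof -
    have K: "0 \<le> K r" if r: "s0 \<le> r" "r < s" for r
    proof -
      have "K s0 + 0 * (r - s0) \<le> K r"
        using r s pos b by (intro deriv_ge_imp_ge[OF _ contK K']) (auto intro: less_imp_le)
      then show ?thesis using K0' by simp
    qed
    have "D s0 + 0 * (s - s0) \<le> D s"
    proof (rule deriv_ge_imp_ge[OF _ contD D'])
      fix r assume r: "s0 < r" "r < s"
      then have V: "0 < V1 r" "V1 r < V2 r"
        using pos[of r] P1.Vpos[of r] s by (auto simp: D_def \<Lambda>_def)
      have "G1 r \<le> 0" using P1.Gneg[of r] r s by (auto simp: \<Lambda>_def)
      then have "G1 r / V1 r \<le> G1 r / V2 r"
        using V by (intro divide_left_mono_neg) auto
      also have "\<dots> \<le> G2 r / V2 r"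
        using K[of r] r V by (intro divide_right_mono) (auto simp: K_def)
      finally show "0 \<le> G2 r / V2 r - G1 r / V1 r" by simp
    qed (use s in auto)
    then show ?thesis by simp
  qed
  have pos: "0 < D s" if s: "s0 \<le> s" "s < \<Lambda>" for s
  proof (rule ccontr)
    assume n: "\<not> 0 < D s"
    have c: "continuous_on {s0..s} (\<lambda>s. - D s)" using contD[OF s(2)] by (rule continuous_on_minus)
    have n: "0 \<le> - D s" and p: "- D s0 < 0" using n D0' by simp_all
    from first_zero[OF c s(1) p n] obtain \<sigma> where \<sigma>: "s0 < \<sigma>" "\<sigma> \<le> s" "- D \<sigma> = 0"
      "\<And>r. s0 \<le> r \<Longrightarrow> r < \<sigma> \<Longrightarrow> - D r < 0" by blast
    have "D s0 \<le> D \<sigma>" using \<sigma> s by (intro growth) auto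
    then show False using \<sigma> D0' by simp
  qed
  have ge: "D s0 \<le> D s" if "s0 \<le> s" "s < \<Lambda>" for s
    using that pos by (intro growth) auto
  \<comment> \<open>Mere monotonicity of K would not do, since K(s0) may be 0; the linear growth
    gives a definite gap at the right end.\<close>
  have Kge: "b * D s0 * (s - s0) \<le> K s" if "s0 \<le> s" "s < \<Lambda>" for s
  proof -
    have "K s0 + b * D s0 * (s - s0) \<le> K s"
      using that ge b by (intro deriv_ge_imp_ge[OF _ contK K']) auto
    then show ?thesis using K0' by simp
  qed
  have ev: "\<forall>\<^sub>F s in at_left \<Lambda>. s0 \<le> s \<and> s < \<Lambda>"
    using eventually_at_left_real[OF \<Lambda>] by eventually_elim auto
  \<comment> \<open>The profile that ends first gives the contradiction. If it is the second, V2 >=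
    D(s0) cannot tend to 0. If it is the first, G2 <= 0 turns the lower bound on K into one for -G1,
    which then cannot tend to 0.\<close>
  show False
  proof (cases "L2 \<le> L1")
    case True
    then have L: "\<Lambda> = L2" by (simp add: \<Lambda>_def)
    have "\<forall>\<^sub>F s in at_left L2. D s0 \<le> V2 s"
      using ev unfolding L
    proof eventually_elim
      case (elim s)
      then show ?case using ge[of s] P1.Vpos[of s] L True by (auto simp: D_def)
    qed
    then have "D s0 \<le> 0"
      by (rule tendsto_lowerbound[OF P2.Vlim]) simp
    then show False using D0' by simp
  next
    case False
    then have L: "\<Lambda> = L1" by (simp add: \<Lambda>_def)
    have "\<forall>\<^sub>F s in at_left L1. b * D s0 * (s - s0) \<le> - G1 s"
      using ev unfolding L
    proof eventually_elim
      case (elim s)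
      then show ?case using Kge[of s] P2.Gneg[of s] L False by (auto simp: K_def)
    qed
    moreover have "((\<lambda>s. - G1 s) \<longlongrightarrow> - 0) (at_left L1)"
      by (intro tendsto_minus P1.Glim)
    moreover have "((\<lambda>s. b * D s0 * (s - s0)) \<longlongrightarrow> b * D s0 * (L1 - s0)) (at_left L1)"
      by (intro tendsto_intros)
    ultimately have "b * D s0 * (L1 - s0) \<le> - 0"
      using tendsto_le[OF trivial_limit_at_left_real] by blast
    moreover have "b * D s0 * (L1 - s0) > 0" using b D0' P1.less by simp
    ultimately show False by simp
  qed
qed

section \<open>Signs, monotonicity and limits of an arbitrary bounded solution\<close>

locale bounded_solution =
  fixes a b :: real and x y z :: "real \<Rightarrow> real"
  assumes a: "0 < a" and b: "0 < b" "b \<le> a"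
    and x': "\<And>t. t \<ge> 0 \<Longrightarrow> (x has_real_derivative y t) (at t within {0..})"
    and y': "\<And>t. t \<ge> 0 \<Longrightarrow> (y has_real_derivative z t) (at t within {0..})"
    and z': "\<And>t. t \<ge> 0 \<Longrightarrow> (z has_real_derivative - a * x t * z t - (a - b) * (y t)\<^sup>2) (at t within {0..})"
    and z0: "z 0 = - 1"
    and ylim: "(y \<longlongrightarrow> 0) at_top"
    and bounded: "bounded (x ` {0..})"
begin

definition e where "e t = z t + a * x t * y t"

lemma e': "t \<ge> 0 \<Longrightarrow> (e has_real_derivative b * (y t)\<^sup>2) (at t within {0..})"
  unfolding e_def
  by (rule derivative_eq_intros x' y' z' refl | assumption)+
    (simp add: power2_eq_square left_diff_distrib)

lemma obtain_bound: obtains K where "K \<ge> 0" "\<And>t. t \<ge> 0 \<Longrightarrow> \<bar>x t\<bar> \<le> K"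
proof -
  obtain K where K: "\<forall>v\<in>x ` {0..}. norm v \<le> K" using bounded by (auto simp: bounded_iff)
  then have "\<bar>x t\<bar> \<le> K" if "t \<ge> 0" for t using that by auto
  moreover from this[of 0] have "K \<ge> 0" by simp
  ultimately show thesis by (rule that[rotated])
qed

text \<open>The same linear comparison as in the shooting region, with the assumed bound on x in the
  place of \<open>M\<close>.\<close>

lemma z_neg: assumes "t \<ge> 0" shows "z t < 0"
proof -
  obtain K where K: "K \<ge> 0" "\<And>t. t \<ge> 0 \<Longrightarrow> \<bar>x t\<bar> \<le> K" using obtain_bound by blast
  show ?thesis
  proof (rule linear_ineq_stays_negative[OF z', of t "a * K"])
    fix r assume r: "0 \<le> r" "z r \<le> 0"
    have "- (a * x r) * z r \<le> - (a * K) * z r"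
      using K(2)[of r] r a by (intro mult_right_mono_neg) auto
    moreover have "0 \<le> (a - b) * (y r)\<^sup>2" using b by simp
    ultimately show "- a * x r * z r - (a - b) * (y r)\<^sup>2 \<le> - (a * K) * z r" by simp
  qed (use z0 assms in auto)
qed

lemma y_strict: "0 \<le> r \<Longrightarrow> r < t \<Longrightarrow> y t < y r"
  using z_neg by (intro halfline_less[OF y']) auto

lemma y_pos: assumes "t \<ge> 0" shows "0 < y t"
proof -
  have "\<forall>\<^sub>F u in at_top. y u \<le> y (t + 1)"
    using eventually_gt_at_top[of "t + 1"]
    by eventually_elim (use y_strict[of "t + 1"] assms in \<open>auto intro: less_imp_le\<close>)
  then have "0 \<le> y (t + 1)"
    by (rule tendsto_upperbound[OF ylim]) simp
  then show ?thesis using y_strict[of t "t + 1"] assms by simp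
qed

lemma x_strict: "0 \<le> r \<Longrightarrow> r < t \<Longrightarrow> x r < x t"
  using halfline_less[of "\<lambda>t. - x t" "\<lambda>t. - y t" r t] DERIV_minus[OF x'] y_pos by simp

lemma e_mono: "0 \<le> r \<Longrightarrow> r \<le> t \<Longrightarrow> e r \<le> e t"
  using halfline_ge[OF e', of r t 0] b by simp

lemma xy_lim: "((\<lambda>t. a * x t * y t) \<longlongrightarrow> 0) at_top"
proof -
  obtain K where K: "K \<ge> 0" "\<And>t. t \<ge> 0 \<Longrightarrow> \<bar>x t\<bar> \<le> K" using obtain_bound by blast
  have "((\<lambda>t. a * K * \<bar>y t\<bar>) \<longlongrightarrow> a * K * 0) at_top"
    by (intro tendsto_intros tendsto_rabs_zero ylim)
  then have "((\<lambda>t. a * K * \<bar>y t\<bar>) \<longlongrightarrow> 0) at_top" by simp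
  moreover have "\<forall>\<^sub>F t in at_top. norm (a * x t * y t) \<le> a * K * \<bar>y t\<bar>"
    using eventually_ge_at_top[of 0]
    by eventually_elim (use K a in \<open>auto simp: abs_mult intro!: mult_right_mono\<close>)
  ultimately show ?thesis by (rule Lim_null_comparison[rotated])
qed

text \<open>Since z < 0, e lies below a x y, which tends to 0 because x is bounded. A nondecreasing
  function with such a majorant is nonpositive.\<close>

lemma e_nonpos: assumes "t \<ge> 0" shows "e t \<le> 0"
proof -
  have "\<forall>\<^sub>F u in at_top. e t \<le> a * x u * y u"
    using eventually_ge_at_top[of t]
  proof eventually_elim
    case (elim u)
    then show ?case using e_mono[OF assms elim] z_neg[of u] assms by (simp add: e_def)
  qed
  then show ?thesis by (rule tendsto_lowerbound[OF xy_lim]) simp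
qed

text \<open>If e stayed below -\<epsilon>, then z = e - a x y would eventually be at most
  -\<epsilon>/2 and would drive y below 0. Monotonicity and \<open>e_nonpos\<close> do the
  rest.\<close>

lemma e_lim: "(e \<longlongrightarrow> 0) at_top"
proof (rule tendstoI)
  fix \<epsilon> :: real assume \<epsilon>: "\<epsilon> > 0"
  have "\<exists>t\<ge>0. - \<epsilon> < e t"
  proof (rule ccontr)
    assume "\<not> ?thesis"
    then have le: "e t \<le> - \<epsilon>" if "t \<ge> 0" for t using that by force
    have "\<forall>\<^sub>F t in at_top. dist (a * x t * y t) 0 < \<epsilon> / 2"
      using tendstoD[OF xy_lim, of "\<epsilon> / 2"] \<epsilon> by simp
    then obtain T0 where T0: "\<And>t. t \<ge> T0 \<Longrightarrow> \<bar>a * x t * y t\<bar> < \<epsilon> / 2"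
      by (auto simp: eventually_at_top_linorder)
    define T where "T = max T0 0"
    \<comment> \<open>The time at which the line of slope -\<epsilon>/2 starting from y(T) reaches
      0.\<close>
    define u where "u = T + 2 * y T / \<epsilon>"
    have T: "T \<ge> 0" by (simp add: T_def)
    then have u: "T \<le> u" using y_pos[of T] \<epsilon> by (simp add: u_def)
    have "y u \<le> y T + (- (\<epsilon> / 2)) * (u - T)"
    proof (rule halfline_le[OF y'])
      fix t assume "T < t"
      then show "z t \<le> - (\<epsilon> / 2)" using T0[of t] le[of t] T by (auto simp: e_def T_def)
    qed (use T u in auto)
    then have "y u \<le> 0" using \<epsilon> by (simp add: u_def)
    then show False using y_pos[of u] T u by simp
  qed
  then obtain t where t: "t \<ge> 0" "- \<epsilon> < e t" by auto
  show "\<forall>\<^sub>F u in at_top. dist (e u) 0 < \<epsilon>"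
    using eventually_ge_at_top[of t]
  proof eventually_elim
    case (elim u)
    then show ?case using e_mono[OF t(1) elim] e_nonpos[of u] t by simp
  qed
qed

text \<open>x is strictly increasing, so time can be eliminated through its inverse g. As s
  approaches L = sup x, g(s) tends to infinity, and the limits of y and e at infinity become the
  limits of the profile at L.\<close>

lemma profile_exists: "\<exists>L V G. profile a b (x 0) L V G \<and> V (x 0) = y 0 \<and> G (x 0) = e 0"
proof -
  define L where "L = Sup (x ` {0..})"
  have bdd: "bdd_above (x ` {0..})" using bounded by (rule bounded_imp_bdd_above)
  have xL: "x t < L" if "t \<ge> 0" for t
  proof -
    have "x t < x (t + 1)" using that x_strict by simp
    also have "\<dots> \<le> L" unfolding L_def using that bdd by (intro cSup_upper) auto
    finally show ?thesis .
  qed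
  have contx: "continuous_on {0..} x" by (rule halfline_continuous_on[OF x'])
  have x0: "x 0 \<le> x t" if "t \<ge> 0" for t using that x_strict[of 0 t] by (cases "t = 0") auto
  \<comment> \<open>Half-open on the right, because a strictly increasing function on the half-line
    does not attain its supremum.\<close>
  have image: "x ` {0..} = {x 0..<L}"
  proof
    show "x ` {0..} \<subseteq> {x 0..<L}" using xL x0 by auto
    show "{x 0..<L} \<subseteq> x ` {0..}"
    proof
      fix s assume s: "s \<in> {x 0..<L}"
      then have "s < Sup (x ` {0..})" by (simp add: L_def)
      then obtain t where t: "t \<ge> 0" "s < x t"
        using less_cSup_iff[OF _ bdd] by auto
      have "continuous_on {0..t} x" using contx by (rule continuous_on_subset) auto
      then obtain r where "0 \<le> r" "r \<le> t" "x r = s"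
        using IVT'[of x 0 s t] s t by auto
      then show "s \<in> x ` {0..}" by auto
    qed
  qed
  have inj: "inj_on x {0..}"
    by (rule linorder_inj_onI) (use x_strict in force)+
  have "path_connected {0::real..}"
    by (intro convex_imp_path_connected) auto
  then obtain g where g: "homeomorphism {0..} {x 0..<L} x g"
    using homeomorphism_into_1d[OF _ contx image inj] by blast
  have gx: "g (x t) = t" if "t \<ge> 0" for t using homeomorphism_apply1[OF g] that by simp
  have xg: "x (g s) = s" and g0: "0 \<le> g s" if "x 0 \<le> s" "s < L" for s
    using homeomorphism_apply2[OF g] homeomorphism_image2[OF g] that by auto
  have contg: "continuous_on {x 0..<L} g" using g by (rule homeomorphism_cont2)
  have gpos: "0 < g s" if "x 0 < s" "s < L" for s
    using xg[of s] g0[of s] that by (cases "g s = 0") auto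
  have two_sided: "(f has_real_derivative d) (at (g s))"
    if "(f has_real_derivative d) (at (g s) within {0..})" "x 0 < s" "s < L" for f d s
    using that gpos[of s] at_within_interior[of "g s" "{0..}"] by simp
  have g': "(g has_real_derivative inverse (y (g s))) (at s)" if s: "x 0 < s" "s < L" for s
  proof (rule DERIV_inverse_function[where f = x and a = "x 0" and b = L])
    show "(x has_real_derivative y (g s)) (at (g s))"
      using s g0[of s] by (intro two_sided x') auto
    show "y (g s) \<noteq> 0" using y_pos[of "g s"] g0[of s] s by simp
    have "continuous_on {x 0<..<L} g" using contg by (rule continuous_on_subset) auto
    then show "isCont g s" using s by (simp add: continuous_on_eq_continuous_at)
  qed (use s xg in auto)
  have gtop: "filterlim g at_top (at_left L)"
  proof (subst filterlim_at_top, intro allI)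
    fix Z :: real
    define T where "T = max Z 0"
    have "x T < L" using xL by (simp add: T_def)
    from eventually_at_left_real[OF this] show "\<forall>\<^sub>F s in at_left L. Z \<le> g s"
    proof eventually_elim
      case (elim s)
      have "x 0 \<le> x T" using x0 by (simp add: T_def)
      then have s: "x 0 \<le> s" "s < L" using elim by auto
      have "\<not> g s < T" using x_strict[of "g s" T] xg[OF s] g0[OF s] elim by auto
      then show ?case by (simp add: T_def)
    qed
  qed
  have "profile a b (x 0) L (\<lambda>s. y (g s)) (\<lambda>s. e (g s))"
  proof
    show "x 0 < L" using xL by simp
    show "continuous_on {x 0..<L} (\<lambda>s. y (g s))"
      by (rule continuous_on_compose2[OF halfline_continuous_on[OF y'] contg]) (use g0 in auto)
    show "continuous_on {x 0..<L} (\<lambda>s. e (g s))"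
      by (rule continuous_on_compose2[OF halfline_continuous_on[OF e'] contg]) (use g0 in auto)
  next
    fix s assume s: "x 0 < s" "s < L"
    have gs: "0 \<le> g s" "x (g s) = s" "0 < y (g s)" using s g0[of s] xg[of s] y_pos by auto
    \<comment> \<open>The chain rule gives z / y, and z = e - a x y with x(g(s)) = s.\<close>
    show "((\<lambda>s. y (g s)) has_real_derivative e (g s) / y (g s) - a * s) (at s)"
      by (rule DERIV_cong[OF DERIV_chain2[OF two_sided[OF y'[OF gs(1)] s] g'[OF s]]])
        (use gs in \<open>simp add: e_def field_simps\<close>)
    show "((\<lambda>s. e (g s)) has_real_derivative b * y (g s)) (at s)"
      by (rule DERIV_cong[OF DERIV_chain2[OF two_sided[OF e'[OF gs(1)] s] g'[OF s]]])
        (use gs in \<open>simp add: power2_eq_square\<close>)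
  next
    fix s assume "x 0 \<le> s" "s < L"
    then show "0 < y (g s)" "e (g s) \<le> 0" using y_pos e_nonpos g0 by auto
  next
    show "((\<lambda>s. y (g s)) \<longlongrightarrow> 0) (at_left L)" "((\<lambda>s. e (g s)) \<longlongrightarrow> 0) (at_left L)"
      by (rule filterlim_compose[OF ylim gtop] filterlim_compose[OF e_lim gtop])+
  qed
  moreover have "g (x 0) = 0" by (rule gx) simp
  ultimately show ?thesis
    by (intro exI[of _ L] exI[of _ "\<lambda>s. y (g s)"] exI[of _ "\<lambda>s. e (g s)"]) simp
qed

text \<open>With cut-offs at or above the bounds of a given solution, clipping leaves that solution
  unchanged. Two bounded solutions can thus be viewed as flows of one Lipschitz field, to which
  \<open>flow_dist\<close> applies.\<close>

lemma is_flow: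
  assumes M: "\<And>t. t \<ge> 0 \<Longrightarrow> \<bar>x t\<bar> \<le> M" and Y: "y 0 \<le> Y"
  shows "is_flow a b M Y x (\<lambda>t. y t + a / 2 * (x t)\<^sup>2) e"
  unfolding is_flow_def
proof (intro allI impI)
  fix t :: real assume t: "0 \<le> t"
  have "y t \<le> Y" using y_strict[of 0 t] t Y by (cases "t = 0") auto
  moreover have slope: "slope a M (x t) (y t + a / 2 * (x t)\<^sup>2) = y t"
    using M[OF t] by (simp add: slope_def clip_id)
  ultimately have "clip 0 Y (slope a M (x t) (y t + a / 2 * (x t)\<^sup>2)) = y t"
    using y_pos[OF t] by (simp add: clip_id)
  moreover have "((\<lambda>t. y t + a / 2 * (x t)\<^sup>2) has_real_derivative e t) (at t within {0..})"
    by (rule derivative_eq_intros x' y' refl t)+ (simp add: e_def)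
  ultimately show "(x has_real_derivative slope a M (x t) (y t + a / 2 * (x t)\<^sup>2)) (at t within {0..}) \<and>
      ((\<lambda>t. y t + a / 2 * (x t)\<^sup>2) has_real_derivative e t) (at t within {0..}) \<and>
      (e has_real_derivative b * (clip 0 Y (slope a M (x t) (y t + a / 2 * (x t)\<^sup>2)))\<^sup>2) (at t within {0..})"
    using x'[OF t] e'[OF t] slope by simp
qed

end

section \<open>Uniqueness of the bounded solution for a nonnegative initial value\<close>

lemma bounded_solution_initial_slope_le:
  assumes "bounded_solution a b x1 y1 z1" "bounded_solution a b x2 y2 z2"
    and x: "x1 0 = x2 0" "0 \<le> x1 0"
  shows "y2 0 \<le> y1 0"
proof (rule ccontr)
  interpret S1: bounded_solution a b x1 y1 z1 by fact
  interpret S2: bounded_solution a b x2 y2 z2 by fact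
  assume less: "\<not> y2 0 \<le> y1 0"
  obtain L1 V1 G1 where P1: "profile a b (x1 0) L1 V1 G1" "V1 (x1 0) = y1 0" "G1 (x1 0) = S1.e 0"
    using S1.profile_exists by blast
  obtain L2 V2 G2 where P2: "profile a b (x2 0) L2 V2 G2" "V2 (x2 0) = y2 0" "G2 (x2 0) = S2.e 0"
    using S2.profile_exists by blast
  \<comment> \<open>Both solutions have e(0) = -1 + a x(0) y(0), so x(0) >= 0 orders the values e(0)
    like the initial slopes.\<close>
  have "a * x2 0 * y1 0 \<le> a * x2 0 * y2 0"
    using less x S1.a by (intro mult_left_mono) auto
  then have "S1.e 0 \<le> S2.e 0"
    using x by (simp add: S1.e_def S2.e_def S1.z0 S2.z0)
  then show False
    using P1 P2 less x S1.b by (intro profile_compare[of a b "x1 0" L1 V1 G1 L2 V2 G2]) auto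
qed

lemma bounded_solution_unique:
  assumes "bounded_solution a b x1 y1 z1" "bounded_solution a b x2 y2 z2"
    and x: "x1 0 = x2 0" "0 \<le> x1 0" and t: "t \<ge> 0"
  shows "x1 t = x2 t"
proof -
  interpret S1: bounded_solution a b x1 y1 z1 by fact
  interpret S2: bounded_solution a b x2 y2 z2 by fact
  have y: "y1 0 = y2 0"
    using bounded_solution_initial_slope_le[OF assms(1,2) x]
      bounded_solution_initial_slope_le[OF assms(2,1)] x by simp
  then have e: "S1.e 0 = S2.e 0" using x by (simp add: S1.e_def S2.e_def S1.z0 S2.z0)
  obtain K1 where K1: "K1 \<ge> 0" "\<And>t. t \<ge> 0 \<Longrightarrow> \<bar>x1 t\<bar> \<le> K1" using S1.obtain_bound by blast
  obtain K2 where K2: "K2 \<ge> 0" "\<And>t. t \<ge> 0 \<Longrightarrow> \<bar>x2 t\<bar> \<le> K2" using S2.obtain_bound by blast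
  define M where "M = max K1 K2"
  have M: "M \<ge> 0" using K1 by (simp add: M_def)
  have F1: "is_flow a b M (y1 0) x1 (\<lambda>t. y1 t + a / 2 * (x1 t)\<^sup>2) S1.e"
    using K1(2) by (intro S1.is_flow) (auto simp: M_def le_max_iff_disj)
  have F2: "is_flow a b M (y1 0) x2 (\<lambda>t. y2 t + a / 2 * (x2 t)\<^sup>2) S2.e"
    using K2(2) y by (intro S2.is_flow) (auto simp: M_def le_max_iff_disj)
  have "0 \<le> y1 0" using S1.y_pos[of 0] by simp
  then obtain C where C: "\<forall>x w e x' w' e' t. is_flow a b M (y1 0) x w e \<longrightarrow> is_flow a b M (y1 0) x' w' e' \<longrightarrow> 0 \<le> t \<longrightarrow>
    \<bar>x t - x' t\<bar> + \<bar>w t - w' t\<bar> + \<bar>e t - e' t\<bar>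
      \<le> 3 * exp (C * t) * (\<bar>x 0 - x' 0\<bar> + \<bar>w 0 - w' 0\<bar> + \<bar>e 0 - e' 0\<bar>)"
    using flow_dist[of a b M "y1 0"] M S1.a S1.b by auto
  from C[rule_format, OF F1 F2 t]
show ?thesis using x y e by simp
qed


section \<open>The boundary value problem\<close>

text \<open>The filter within the half-line contains the right-hand neighbourhood filter as a finer
  one, so it is nontrivial even at 0 and the derivative is unique.\<close>

lemma hderiv_eq:
  assumes "t \<ge> 0" "(f has_real_derivative d) (at t within {0..})"
  shows "hderiv f t = d"
proof -
  have "at_right t \<le> at t within {0..}" using assms(1) by (intro at_le) auto
  then have "at t within {0..} \<noteq> bot"
    using trivial_limit_at_right_real[of t] by (metis bot.extremum_uniqueI)
  then show ?thesis
    using assms(2) unfolding hderiv_def has_real_derivative_iff_has_vector_derivative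
    by (rule vector_derivative_within)
qed

text \<open>\<open>hderiv f\<close> and \<open>g\<close> are only known to agree on
  \<open>{0..}\<close>, which is enough for a derivative within that set.\<close>

lemma hderiv_has_derivative:
  assumes f: "\<And>t. t \<ge> 0 \<Longrightarrow> (f has_real_derivative g t) (at t within {0..})"
    and g: "\<And>t. t \<ge> 0 \<Longrightarrow> (g has_real_derivative h t) (at t within {0..})"
    and t: "t \<ge> 0"
  shows "(hderiv f has_real_derivative h t) (at t within {0..})"
  unfolding has_real_derivative_iff_has_vector_derivative
proof (rule has_vector_derivative_transform)
  show "(g has_vector_derivative h t) (at t within {0..})"
    using g[OF t] by (simp add: has_real_derivative_iff_has_vector_derivative)
qed (use t hderiv_eq[OF _ f] in auto)

lemma has_derivative_hderiv:
  assumes "f differentiable_on {0..}" "t \<ge> 0"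
  shows "(f has_real_derivative hderiv f t) (at t within {0..})"
  using assms unfolding hderiv_def has_real_derivative_iff_has_vector_derivative
  by (simp add: differentiable_on_def vector_derivative_works[symmetric])

lemma bvp_solution_imp_bounded_solution:
  assumes m: "- 1 < m" "m \<le> - 1 / 2"
    and f: "bvp_solution m \<gamma> f" "bounded (f ` {0..})"
  shows "bounded_solution (m + 2) (3 * (m + 1)) f (hderiv f) (hderiv (hderiv f))"
proof
  fix t :: real assume t: "t \<ge> 0"
  have d: "f differentiable_on {0..}" "hderiv f differentiable_on {0..}"
    "hderiv (hderiv f) differentiable_on {0..}"
    using f(1) by (auto simp: bvp_solution_def three_times_differentiable_def)
  show "(f has_real_derivative hderiv f t) (at t within {0..})"
    "(hderiv f has_real_derivative hderiv (hderiv f) t) (at t within {0..})"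
    using d t by (auto intro: has_derivative_hderiv)
  have "hderiv (hderiv (hderiv f)) t
      = - (m + 2) * f t * hderiv (hderiv f) t - (m + 2 - 3 * (m + 1)) * (hderiv f t)\<^sup>2"
    using f(1) t by (auto simp: bvp_solution_def algebra_simps)
  then show "(hderiv (hderiv f) has_real_derivative
      - (m + 2) * f t * hderiv (hderiv f) t - (m + 2 - 3 * (m + 1)) * (hderiv f t)\<^sup>2) (at t within {0..})"
    using has_derivative_hderiv[OF d(3) t] by simp
qed (use m f in \<open>auto simp: bvp_solution_def\<close>)

text \<open>The mean value theorem on either side of the intermediate point compares two chord
  slopes, and the left one is strictly larger.\<close>

lemma strictly_concave_onI:
  assumes f: "\<And>t. t \<ge> 0 \<Longrightarrow> (f has_real_derivative f' t) (at t within {0..})"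
    and dec: "\<And>r t. 0 \<le> r \<Longrightarrow> r < t \<Longrightarrow> f' t < f' r"
  shows "strictly_concave_on {0..} f"
  unfolding strictly_concave_on_def
proof (intro conjI ballI allI impI)
  have less: "(1 - u) * f p + u * f q < f ((1 - u) * p + u * q)"
    if pq: "0 \<le> p" "p < q" and u: "0 < u" "u < 1" for p q u
  proof -
    define v where "v = (1 - u) * p + u * q"
    have pv: "v - p = u * (q - p)" and vq: "q - v = (1 - u) * (q - p)"
      by (simp_all add: v_def algebra_simps)
    have "0 < v - p" "0 < q - v" unfolding pv vq using pq u by simp_all
    then have v: "p < v" "v < q" by simp_all
    obtain \<xi> where \<xi>: "p < \<xi>" "\<xi> < v" "f v - f p = (v - p) * f' \<xi>"
      using halfline_MVT[of p v f f'] f pq v by auto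
    obtain \<eta> where \<eta>: "v < \<eta>" "\<eta> < q" "f q - f v = (q - v) * f' \<eta>"
      using halfline_MVT[of v q f f'] f pq v by auto
    have "f' \<eta> < f' \<xi>" using dec[of \<xi> \<eta>] \<xi> \<eta> pq by simp
    then have "u * (1 - u) * (q - p) * f' \<eta> < u * (1 - u) * (q - p) * f' \<xi>"
      using pq u by (intro mult_strict_left_mono) auto
    then have "u * (f q - f v) < (1 - u) * (f v - f p)"
      unfolding \<xi>(3) \<eta>(3) pv vq by (simp add: mult_ac)
    then have "(1 - u) * f p + u * f q < f v" by (simp add: algebra_simps)
    then show ?thesis by (simp only: v_def)
  qed
  fix p q u :: real
  assume *: "p \<in> {0..}" "q \<in> {0..}" "p \<noteq> q" "0 < u" "u < 1"
  show "(1 - u) * f p + u * f q < f ((1 - u) * p + u * q)"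
  proof (cases "p < q")
    case True
    then show ?thesis using * less by simp
  next
    case False
    then show ?thesis using less[of q p "1 - u"] * by (simp add: add.commute)
  qed
qed auto

lemma bounded_solution_exists:
  assumes m: "- 1 < m" "m \<le> - 1 / 2"
  shows "\<exists>f. bvp_solution m \<gamma> f \<and> bounded (f ` {0..}) \<and> (\<forall>\<^sub>F t in at_top. f t > 0) \<and>
    strict_mono_on {0..} f \<and> strictly_concave_on {0..} f \<and>
    (\<forall>t\<ge>0. - \<gamma> \<le> f t \<and> f t \<le> sqrt (\<gamma>\<^sup>2 + 2 * (hderiv f 0 / (m + 2))))"
proof -
  define a b where "a = m + 2" and "b = 3 * (m + 1)"
  have ab: "0 < a" "a \<le> 3 / 2" "0 < b" "b \<le> a" using m by (simp_all add: a_def b_def)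
  obtain \<alpha> x y z where init: "x 0 = - \<gamma>" "y 0 = \<alpha>" "z 0 = - 1"
    and x': "\<And>t. t \<ge> 0 \<Longrightarrow> (x has_real_derivative y t) (at t within {0..})"
    and y': "\<And>t. t \<ge> 0 \<Longrightarrow> (y has_real_derivative z t) (at t within {0..})"
    and z': "\<And>t. t \<ge> 0 \<Longrightarrow> (z has_real_derivative - a * x t * z t - (a - b) * (y t)\<^sup>2) (at t within {0..})"
    and y0: "\<And>t. t \<ge> 0 \<Longrightarrow> 0 \<le> y t" and z0: "\<And>t. t \<ge> 0 \<Longrightarrow> z t < 0"
    and x2: "\<And>t. t \<ge> 0 \<Longrightarrow> a / 2 * (x t)\<^sup>2 \<le> \<alpha> + a / 2 * \<gamma>\<^sup>2"
    using global_phase[OF ab, of \<gamma>] by blast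
  have y_strict: "y t < y r" if "0 \<le> r" "r < t" for r t :: real
    using that z0 by (intro halfline_less[OF y']) auto
  have y_pos: "0 < y t" if "t \<ge> 0" for t
    using y_strict[of t "t + 1"] y0[of "t + 1"] that by simp
  have x_strict: "x r < x t" if "0 \<le> r" "r < t" for r t :: real
    using halfline_less[of "\<lambda>t. - x t" "\<lambda>t. - y t" r t] DERIV_minus[OF x'] y_pos that by simp
  have lower: "- \<gamma> \<le> x t" if "t \<ge> 0" for t
    using x_strict[of 0 t] init that by (cases "t = 0") auto
  have sqrt: "\<bar>x t\<bar> \<le> sqrt (\<gamma>\<^sup>2 + 2 * (\<alpha> / a))" if "t \<ge> 0" for t
  proof (rule real_le_rsqrt[of "\<bar>x t\<bar>", unfolded power2_abs])
    have "2 / a * (a / 2 * (x t)\<^sup>2) \<le> 2 / a * (\<alpha> + a / 2 * \<gamma>\<^sup>2)"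
      using x2[OF that] ab by (intro mult_left_mono) auto
    then show "(x t)\<^sup>2 \<le> \<gamma>\<^sup>2 + 2 * (\<alpha> / a)"
      using ab by (simp add: distrib_left)
  qed
  define R where "R = sqrt (\<gamma>\<^sup>2 + 2 * (\<alpha> / a))"
  have bdd: "bounded (x ` {0..})"
    using sqrt by (auto simp: bounded_iff)
  have hx: "hderiv x t = y t" if "t \<ge> 0" for t using that x' by (intro hderiv_eq)
  have hx': "(hderiv x has_real_derivative z t) (at t within {0..})" if "t \<ge> 0" for t
    using x' y' that by (rule hderiv_has_derivative)
  have hhx: "hderiv (hderiv x) t = z t" if "t \<ge> 0" for t using that hx' by (intro hderiv_eq)
  have hhx': "(hderiv (hderiv x) has_real_derivative
      - a * x t * z t - (a - b) * (y t)\<^sup>2) (at t within {0..})" if "t \<ge> 0" for t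
    using hx' z' that by (rule hderiv_has_derivative)
  have ylim: "(hderiv x \<longlongrightarrow> 0) at_top"
  proof (rule tendstoI)
    fix \<epsilon> :: real assume \<epsilon>: "\<epsilon> > 0"
    have "\<exists>t\<ge>0. y t < \<epsilon>"
    proof (rule ccontr)
      assume "\<not> ?thesis"
      then have ge: "\<epsilon> \<le> y t" if "t \<ge> 0" for t using that by force
      \<comment> \<open>Climbing from -\<gamma> with slope at least \<epsilon>, x reaches R + 1 by
        this time, above its bound R.\<close>
      define t where "t = (R + \<gamma> + 1) / \<epsilon>"
      have "- \<gamma> \<le> R" using sqrt[of 0] init by (simp add: R_def)
      then have t: "t \<ge> 0" using \<epsilon> by (simp add: t_def)
      have "x 0 + \<epsilon> * (t - 0) \<le> x t" using t ge by (intro halfline_ge[OF x']) auto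
      then have "R + 1 \<le> x t" using \<epsilon> by (simp add: init t_def)
      then show False using sqrt[OF t] by (simp add: R_def)
    qed
    then obtain T where T: "T \<ge> 0" "y T < \<epsilon>" by auto
    show "\<forall>\<^sub>F t in at_top. dist (hderiv x t) 0 < \<epsilon>"
      using eventually_gt_at_top[of T]
    proof eventually_elim
      case (elim t)
      then show ?case using T y_strict[of T t] y_pos[of t] hx[of t] by simp
    qed
  qed
  have bvp: "bvp_solution m \<gamma> x"
    unfolding bvp_solution_def three_times_differentiable_def
  proof (intro conjI allI impI)
    show "x differentiable_on {0..}" "hderiv x differentiable_on {0..}"
      "hderiv (hderiv x) differentiable_on {0..}"
      using x' hx' hhx' by (auto simp: differentiable_on_def real_differentiable_def)
    show "hderiv (hderiv (hderiv x)) t + (m + 2) * x t * hderiv (hderiv x) t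
        - (2 * m + 1) * (hderiv x t)\<^sup>2 = 0" if "t \<ge> 0" for t
      using hderiv_eq[OF that hhx'[OF that]] hx[OF that] hhx[OF that]
      by (simp add: a_def b_def algebra_simps)
  qed (use init hhx ylim in auto)
  \<comment> \<open>If x stayed nonpositive, then x z >= 0 would give z' <= 0 and z <= -1, and y,
    starting from \<alpha>, would be negative by time \<alpha> + 1. One positive value suffices
    because x increases.\<close>
  have "\<exists>t\<ge>0. 0 < x t"
  proof (rule ccontr)
    assume "\<not> ?thesis"
    then have neg: "x t \<le> 0" if "t \<ge> 0" for t using that by force
    have "z t \<le> - 1" if t: "t \<ge> 0" for t
    proof -
      have "z t \<le> z 0 + 0 * (t - 0)"
      proof (rule halfline_le[OF z'])
        fix r :: real assume "0 < r"
        then have "0 \<le> x r * z r" "0 \<le> (a - b) * (y r)\<^sup>2"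
          using neg[of r] z0[of r] ab by (auto intro: mult_nonpos_nonpos)
        moreover have "0 \<le> a * (x r * z r)" using calculation(1) ab by simp
        ultimately show "- a * x r * z r - (a - b) * (y r)\<^sup>2 \<le> 0" by (simp add: mult.assoc)
      qed (use t in auto)
      then show ?thesis by (simp add: init)
    qed
    then have "y (\<alpha> + 1) \<le> y 0 + (- 1) * (\<alpha> + 1 - 0)"
      using y_pos[of 0] init by (intro halfline_le[OF y']) auto
    then show False using y_pos[of "\<alpha> + 1"] y_pos[of 0] init by simp
  qed
  then obtain T where T: "T \<ge> 0" "0 < x T" by auto
  have pos: "\<forall>\<^sub>F t in at_top. x t > 0"
    using eventually_gt_at_top[of T] by eventually_elim (use T x_strict in force)
  have upper: "x t \<le> sqrt (\<gamma>\<^sup>2 + 2 * (hderiv x 0 / (m + 2)))" if "t \<ge> 0" for t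
    using sqrt[OF that] hx[of 0] init by (simp add: a_def)
  have mono: "strict_mono_on {0..} x"
    using x_strict by (auto simp: strict_mono_on_def)
  show ?thesis
    using bvp bdd pos mono strictly_concave_onI[OF x' y_strict] lower upper by blast
qed

theorem theorem3p4:
  fixes \<gamma> m :: real
  assumes "- 1 < m" and "m \<le> - 1 / 2"
  shows "(\<exists>f. bvp_solution m \<gamma> f \<and> bounded (f ` {0..}) \<and>
            (\<forall>\<^sub>F t in at_top. f t > 0) \<and>
            strict_mono_on {0..} f \<and>
            strictly_concave_on {0..} f \<and>
            (\<forall>t\<ge>0. - \<gamma> \<le> f t \<and> f t \<le> sqrt (\<gamma>\<^sup>2 + 2 * (hderiv f 0 / (m + 2))))) \<and>
         (\<gamma> \<le> 0 \<longrightarrow>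
           (\<forall>f g. bvp_solution m \<gamma> f \<and> bounded (f ` {0..}) \<and>
                  bvp_solution m \<gamma> g \<and> bounded (g ` {0..}) \<longrightarrow>
                  (\<forall>t\<ge>0. f t = g t)))"
proof (intro conjI impI allI)
  fix f g :: "real \<Rightarrow> real" and t :: real
  assume \<gamma>: "\<gamma> \<le> 0" and t: "t \<ge> 0"
    and fg: "bvp_solution m \<gamma> f \<and> bounded (f ` {0..}) \<and> bvp_solution m \<gamma> g \<and> bounded (g ` {0..})"
  then have init: "f 0 = - \<gamma>" "g 0 = - \<gamma>" by (auto simp: bvp_solution_def)
  have "bounded_solution (m + 2) (3 * (m + 1)) f (hderiv f) (hderiv (hderiv f))"
    "bounded_solution (m + 2) (3 * (m + 1)) g (hderiv g) (hderiv (hderiv g))"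
    using fg by (blast intro: bvp_solution_imp_bounded_solution[OF assms])+
  from bounded_solution_unique[OF this _ _ t] show "f t = g t" using init \<gamma> by simp
qed (rule bounded_solution_exists[OF assms])

end
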